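(* For $t\in\mathbb{R}$ let $U_t(x,y,z)=x^4+tx^2+y^2+z^2$ on $\mathbb{R}^3$. (a) If $t>0$, the growth index of $U_t$ at the origin is $\frac32$. (b) The growth index of $U_0$ at the origin is $\frac54$. (c) If $t<0$, the growth index of $U_t$ at the origin is $1$.
   Context: Growth index: for a real-analytic $f\not\equiv0$ near $0\in\mathbb{R}^n$ with $f(0)=0$, and smooth $\phi\ge0$ with $\phi(0)>0$ supported in a sufficiently small neighborhood of $0$, the integral $I_{f,\phi}(\epsilon)=\int_{\{0<f(x)<\epsilon\}}\phi(x)\,dx$ has an asymptotic expansion $\sum_{j\ge0}\sum_{i=0}^{n-1}c_{ij}(\phi)(\ln\epsilon)^i\epsilon^{r_j}$ as $\epsilon\to0^+$, with $\{r_j\}$ an increasing arithmetic progression of positive rationals independent of $\phi$. The growth index of $f$ at $0$ is the smallest $r_j$ for which some $c_{ij}(\phi)\ne0$ (this does not depend on $\phi$). *)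

theory Defs
  imports "HOL-Analysis.Analysis" "HOL-Library.Landau_Symbols"
begin

text \<open>Continuous differentiability of order \<open>k\<close> on the whole space. In the second clause \<open>v\<close> ranges
  over all directions, so the derivative is \<open>k\<close> times continuously differentiable as a map into the
  linear forms.\<close>

fun Ck :: "nat \<Rightarrow> ('a::euclidean_space \<Rightarrow> real) \<Rightarrow> bool" where
  "Ck 0 f \<longleftrightarrow> continuous_on UNIV f"
| "Ck (Suc k) f \<longleftrightarrow>
     (\<forall>x. f differentiable (at x)) \<and> (\<forall>v. Ck k (\<lambda>x. frechet_derivative f (at x) v))"

definition smooth :: "('a::euclidean_space \<Rightarrow> real) \<Rightarrow> bool" where
  "smooth f \<longleftrightarrow> (\<forall>k. Ck k f)"

text \<open>Real-analyticity near the origin: a power series in \<open>CARD('n)\<close> variables, indexed by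
  multi-indices \<open>\<alpha>\<close>, that sums unconditionally (hence absolutely) to \<open>f\<close> on a ball.\<close>

definition real_analytic_near_0 :: "(real ^ 'n \<Rightarrow> real) \<Rightarrow> bool" where
  "real_analytic_near_0 f \<longleftrightarrow>
     (\<exists>c :: ('n \<Rightarrow> nat) \<Rightarrow> real. \<exists>\<rho>>0. \<forall>x\<in>ball 0 \<rho>.
        ((\<lambda>\<alpha>. c \<alpha> * (\<Prod>i\<in>UNIV. (x $ i) ^ \<alpha> i)) has_sum f x) UNIV)"

text \<open>The zero function is excluded as a germ: \<open>f\<close> vanishes identically on no neighborhood of 0.\<close>

definition admissible_phase :: "(real ^ 'n \<Rightarrow> real) \<Rightarrow> bool" where
  "admissible_phase f \<longleftrightarrow>
     real_analytic_near_0 f \<and> f 0 = 0 \<and> \<not> (\<forall>\<^sub>F x in nhds 0. f x = 0)"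

definition test_function :: "real \<Rightarrow> (real ^ 'n \<Rightarrow> real) \<Rightarrow> bool" where
  "test_function \<rho> \<phi> \<longleftrightarrow>
     smooth \<phi> \<and> (\<forall>x. 0 \<le> \<phi> x) \<and> 0 < \<phi> 0 \<and> closure {x. \<phi> x \<noteq> 0} \<subseteq> ball 0 \<rho>"

definition sublevel_integral ::
    "(real ^ 'n \<Rightarrow> real) \<Rightarrow> (real ^ 'n \<Rightarrow> real) \<Rightarrow> real \<Rightarrow> real" where
  "sublevel_integral f \<phi> \<epsilon> = (LINT x:{x. 0 < f x \<and> f x < \<epsilon>}|lborel. \<phi> x)"

text \<open>Asymptotic, not necessarily convergent, expansion as \<open>\<epsilon>\<close> tends to 0 from the right: the
  remainder after the terms with exponent at most \<open>r J\<close> is negligible against \<open>\<epsilon> powr r J\<close>, the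
  smallest of the scale functions used so far.\<close>

definition has_log_power_expansion ::
    "(real \<Rightarrow> real) \<Rightarrow> nat \<Rightarrow> (nat \<Rightarrow> real) \<Rightarrow> (nat \<Rightarrow> nat \<Rightarrow> real) \<Rightarrow> bool" where
  "has_log_power_expansion I n r c \<longleftrightarrow>
     (\<forall>J. (\<lambda>\<epsilon>. I \<epsilon> - (\<Sum>j\<le>J. \<Sum>i<n. c i j * ln \<epsilon> ^ i * \<epsilon> powr r j))
            \<in> o[at_right 0](\<lambda>\<epsilon>. \<epsilon> powr r J))"

definition rational_progression :: "(nat \<Rightarrow> real) \<Rightarrow> bool" where
  "rational_progression r \<longleftrightarrow>
     (\<exists>a\<in>\<rat>. \<exists>d\<in>\<rat>. 0 < a \<and> 0 < d \<and> (\<forall>j. r j = a + real j * d))"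

text \<open>The existence of the expansion and the independence of the index from the test function are
  part of the predicate: one progression \<open>r\<close> and one value \<open>g\<close> serve all test functions supported
  in a sufficiently small ball, while the coefficients depend on the test function.\<close>

definition has_growth_index :: "(real ^ 'n \<Rightarrow> real) \<Rightarrow> real \<Rightarrow> bool" where
  "has_growth_index f g \<longleftrightarrow>
     admissible_phase f \<and>
     (\<exists>\<rho>>0. \<exists>r. rational_progression r \<and>
        (\<forall>\<phi>. test_function \<rho> \<phi> \<longrightarrow>
           (\<exists>c. has_log_power_expansion (sublevel_integral f \<phi>) CARD('n) r c \<and>
                g \<in> {r j |i j. i < CARD('n) \<and> c i j \<noteq> 0} \<and>
                (\<forall>s \<in> {r j |i j. i < CARD('n) \<and> c i j \<noteq> 0}. g \<le> s))))"

definition U :: "real \<Rightarrow> real ^ 3 \<Rightarrow> real" where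
  "U t p = (p $ 1) ^ 4 + t * (p $ 1)\<^sup>2 + (p $ 2)\<^sup>2 + (p $ 3)\<^sup>2"

end

theory Submission
  imports Defs "HOL-Real_Asymp.Real_Asymp"
begin

text \<open>
  In each case a change of variables with parameter \<open>\<delta> = \<epsilon> powr (1 / q)\<close> carries a fixed set \<open>W\<close> onto the
  sublevel set, so that \<open>I(\<epsilon>) = \<delta> ^ m * J(\<delta>)\<close>, where \<open>J(\<delta>)\<close> integrates over \<open>W\<close> a function which has an
  expansion in powers of \<open>\<delta>\<close> that is uniform on \<open>W\<close>. Integrating termwise expands \<open>J\<close>, and
  \<open>J(0) > 0\<close> gives the growth index \<open>m / q\<close>.

  For \<open>t = 0\<close> the substitution is the dilation \<open>(\<delta>x, \<delta>\<^sup>2y, \<delta>\<^sup>2z)\<close> with \<open>q = 4\<close>, \<open>m = 5\<close>. For \<open>t > 0\<close> the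
  coordinate \<open>X = x sqrt (t + x\<^sup>2)\<close> turns the function into \<open>X\<^sup>2 + y\<^sup>2 + z\<^sup>2\<close>, hence \<open>q = 2\<close>, \<open>m = 3\<close>.
  For \<open>t < 0\<close> the function is \<open>y\<^sup>2 + z\<^sup>2 - h(x)\<close> with \<open>h \<ge> 0\<close> near 0; in polar coordinates in
  the \<open>(y, z)\<close>-plane with squared radius \<open>h(x) + \<delta>s\<close> the Jacobian is \<open>\<delta> / 2\<close>, so \<open>q = m = 1\<close>. There the
  integrand is, after symmetrizing \<open>\<phi>\<close> in \<open>(y, z)\<close>, an even smooth function of the radius, and such a
  function is smooth in the squared radius up to 0, which excludes half-integer powers.
\<close>

section \<open>Uniform asymptotic expansions\<close>

text \<open>Termwise integration needs remainder bounds that do not depend on the point of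
  \<open>W\<close>. An expansion is therefore encoded by the recursion F = c + \<delta> * G, ending
  in a bound uniform on \<open>W\<close>; the closure properties become one-step inductions on the
  order. For t > 0 a linear dilation does not make the region independent of \<delta>, since x^4 and
  x^2 scale differently; X is chosen because X^2 = x^4 + t x^2. For t < 0 the zero set is a surface
  with a conical point at 0, and the sublevel sets are shells along it that do not shrink to 0, so
  \<phi> matters along the whole surface. The difficulty sits where h(x) is small: a Taylor
  expansion in \<delta> of a general function of the radius sqrt (h(x) + \<delta>s) has coefficients
  that blow up as h(x) tends to 0. Differentiating an even function with respect to the squared
  radius costs two ordinary derivatives each time but no division by the radius, so the coefficients
  stay bounded uniformly in x.\<close>

fun uniform_expansion :: "nat \<Rightarrow> 'w set \<Rightarrow> (real \<Rightarrow> 'w \<Rightarrow> real) \<Rightarrow> bool" where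
  "uniform_expansion 0 W F \<longleftrightarrow> (\<exists>B. \<forall>\<^sub>F \<delta> in at_right 0. \<forall>\<omega>\<in>W. \<bar>F \<delta> \<omega>\<bar> \<le> B)"
| "uniform_expansion (Suc n) W F \<longleftrightarrow>
     (\<exists>c G. bounded (c ` W) \<and> uniform_expansion n W G \<and>
        (\<forall>\<^sub>F \<delta> in at_right 0. \<forall>\<omega>\<in>W. F \<delta> \<omega> = c \<omega> + \<delta> * G \<delta> \<omega>))"

lemma eventually_at_right_0_bounds: "\<forall>\<^sub>F \<delta>::real in at_right 0. 0 < \<delta> \<and> \<delta> < 1"
  by (auto simp: eventually_at_right_field intro: exI[of _ 1])

lemma uniform_expansion_cong:
  assumes "uniform_expansion n W F" "\<forall>\<^sub>F \<delta> in at_right 0. \<forall>\<omega>\<in>W. F' \<delta> \<omega> = F \<delta> \<omega>"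
  shows "uniform_expansion n W F'"
proof (cases n)
  case 0
  with assms obtain B where "\<forall>\<^sub>F \<delta> in at_right 0. \<forall>\<omega>\<in>W. \<bar>F \<delta> \<omega>\<bar> \<le> B" by auto
  with assms(2) have "\<forall>\<^sub>F \<delta> in at_right 0. \<forall>\<omega>\<in>W. \<bar>F' \<delta> \<omega>\<bar> \<le> B"
    by eventually_elim auto
  then show ?thesis using 0 by auto
next
  case (Suc m)
  with assms obtain c G where cG: "bounded (c ` W)" "uniform_expansion m W G"
    "\<forall>\<^sub>F \<delta> in at_right 0. \<forall>\<omega>\<in>W. F \<delta> \<omega> = c \<omega> + \<delta> * G \<delta> \<omega>" by auto
  from cG(3) assms(2) have "\<forall>\<^sub>F \<delta> in at_right 0. \<forall>\<omega>\<in>W. F' \<delta> \<omega> = c \<omega> + \<delta> * G \<delta> \<omega>"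
    by eventually_elim auto
  then show ?thesis using Suc cG by auto
qed

lemma uniform_expansion_imp_bounded:
  assumes "uniform_expansion n W F"
  shows "uniform_expansion 0 W F"
  using assms
proof (induction n arbitrary: F)
  case (Suc n)
  then obtain c G where cG: "bounded (c ` W)" "uniform_expansion n W G"
    "\<forall>\<^sub>F \<delta> in at_right 0. \<forall>\<omega>\<in>W. F \<delta> \<omega> = c \<omega> + \<delta> * G \<delta> \<omega>" by auto
  from Suc.IH[OF cG(2)] obtain B where B: "\<forall>\<^sub>F \<delta> in at_right 0. \<forall>\<omega>\<in>W. \<bar>G \<delta> \<omega>\<bar> \<le> B" by auto
  from cG(1) obtain C where C: "\<And>\<omega>. \<omega> \<in> W \<Longrightarrow> \<bar>c \<omega>\<bar> \<le> C"
    by (auto simp: bounded_iff)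
  from B cG(3) eventually_at_right_0_bounds
  have "\<forall>\<^sub>F \<delta> in at_right 0. \<forall>\<omega>\<in>W. \<bar>F \<delta> \<omega>\<bar> \<le> C + B"
  proof eventually_elim
    case (elim \<delta>)
    show ?case
    proof
      fix \<omega> assume w: "\<omega> \<in> W"
      have "\<bar>\<delta> * G \<delta> \<omega>\<bar> \<le> 1 * \<bar>G \<delta> \<omega>\<bar>"
        unfolding abs_mult using elim by (intro mult_right_mono) auto
      then show "\<bar>F \<delta> \<omega>\<bar> \<le> C + B" using elim w C[OF w]
        by (smt (verit))
    qed
  qed
  then show ?case by auto
qed simp

lemma uniform_expansion_const:
  assumes "bounded (c ` W)"
  shows "uniform_expansion n W (\<lambda>\<delta>. c)"
proof (cases n)
  case 0
  then show ?thesis using assms by (force simp: bounded_iff)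
next
  case (Suc m)
  have z: "uniform_expansion m W (\<lambda>\<delta> \<omega>. 0)" for m
    by (induction m) (auto intro!: exI[of _ "\<lambda>_. 0"] exI[of _ "\<lambda>_ _. 0"] simp: bounded_iff)
  show ?thesis unfolding Suc uniform_expansion.simps
    by (rule exI[of _ c], rule exI[of _ "\<lambda>_ _. 0"]) (use assms z in auto)
qed

lemma uniform_expansion_delta_mult:
  assumes "uniform_expansion n W F"
  shows "uniform_expansion (Suc n) W (\<lambda>\<delta> \<omega>. \<delta> * F \<delta> \<omega>)"
  unfolding uniform_expansion.simps
  by (rule exI[of _ "\<lambda>_. 0"], rule exI[of _ F]) (use assms in \<open>auto simp: bounded_iff\<close>)

lemma uniform_expansion_add:
  assumes "uniform_expansion n W F" "uniform_expansion n W F'"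
  shows "uniform_expansion n W (\<lambda>\<delta> \<omega>. F \<delta> \<omega> + F' \<delta> \<omega>)"
  using assms
proof (induction n arbitrary: F F')
  case 0
  then obtain B B' where B: "\<forall>\<^sub>F \<delta> in at_right 0. \<forall>\<omega>\<in>W. \<bar>F \<delta> \<omega>\<bar> \<le> B"
    "\<forall>\<^sub>F \<delta> in at_right 0. \<forall>\<omega>\<in>W. \<bar>F' \<delta> \<omega>\<bar> \<le> B'" by auto
  from B have "\<forall>\<^sub>F \<delta> in at_right 0. \<forall>\<omega>\<in>W. \<bar>F \<delta> \<omega> + F' \<delta> \<omega>\<bar> \<le> B + B'"
    by eventually_elim fastforce
  then show ?case by auto
next
  case (Suc n)
  then obtain c G c' G' where cG: "bounded (c ` W)" "uniform_expansion n W G"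
    "\<forall>\<^sub>F \<delta> in at_right 0. \<forall>\<omega>\<in>W. F \<delta> \<omega> = c \<omega> + \<delta> * G \<delta> \<omega>"
    "bounded (c' ` W)" "uniform_expansion n W G'"
    "\<forall>\<^sub>F \<delta> in at_right 0. \<forall>\<omega>\<in>W. F' \<delta> \<omega> = c' \<omega> + \<delta> * G' \<delta> \<omega>" by auto
  from cG(3,6) have "\<forall>\<^sub>F \<delta> in at_right 0. \<forall>\<omega>\<in>W.
     F \<delta> \<omega> + F' \<delta> \<omega> = (c \<omega> + c' \<omega>) + \<delta> * (G \<delta> \<omega> + G' \<delta> \<omega>)"
    by eventually_elim (auto simp: algebra_simps)
  moreover have "bounded ((\<lambda>\<omega>. c \<omega> + c' \<omega>) ` W)"
    by (rule bounded_plus_comp[OF cG(1,4)])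
  ultimately show ?case using Suc.IH[OF cG(2,5)] unfolding uniform_expansion.simps by blast
qed

text \<open>The inner induction shows that a factor \<delta> preserves the order: if
  \<open>G = d + \<delta> * H\<close>, the hypothesis for \<open>H\<close> gives \<open>G\<close>
  one order lower, and multiplying by \<delta> restores it.\<close>

lemma uniform_expansion_Suc_D:
  assumes "uniform_expansion (Suc n) W F"
  shows "uniform_expansion n W F"
proof -
  from assms obtain c G where cG: "bounded (c ` W)" "uniform_expansion n W G"
    "\<forall>\<^sub>F \<delta> in at_right 0. \<forall>\<omega>\<in>W. F \<delta> \<omega> = c \<omega> + \<delta> * G \<delta> \<omega>" by auto
  have "uniform_expansion n W (\<lambda>\<delta> \<omega>. \<delta> * G \<delta> \<omega>)"
    using cG(2)
  proof (induction n arbitrary: G)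
    case 0
    then show ?case using uniform_expansion_imp_bounded[OF uniform_expansion_delta_mult] by blast
  next
    case (Suc n)
    then obtain d H where dH: "bounded (d ` W)" "uniform_expansion n W H"
      "\<forall>\<^sub>F \<delta> in at_right 0. \<forall>\<omega>\<in>W. G \<delta> \<omega> = d \<omega> + \<delta> * H \<delta> \<omega>" by auto
    have "uniform_expansion n W G"
      by (rule uniform_expansion_cong[OF _ dH(3)])
        (intro uniform_expansion_add uniform_expansion_const dH Suc.IH)
    then show ?case by (rule uniform_expansion_delta_mult)
  qed
  then show ?thesis
    by (intro uniform_expansion_cong[OF _ cG(3)] uniform_expansion_add uniform_expansion_const cG)
qed

lemma uniform_expansion_mult:
  assumes "uniform_expansion n W F" "uniform_expansion n W F'"
  shows "uniform_expansion n W (\<lambda>\<delta> \<omega>. F \<delta> \<omega> * F' \<delta> \<omega>)"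
  using assms
proof (induction n arbitrary: F F')
  case 0
  then obtain B B' where B: "\<forall>\<^sub>F \<delta> in at_right 0. \<forall>\<omega>\<in>W. \<bar>F \<delta> \<omega>\<bar> \<le> B"
    "\<forall>\<^sub>F \<delta> in at_right 0. \<forall>\<omega>\<in>W. \<bar>F' \<delta> \<omega>\<bar> \<le> B'" by auto
  from B have "\<forall>\<^sub>F \<delta> in at_right 0. \<forall>\<omega>\<in>W. \<bar>F \<delta> \<omega> * F' \<delta> \<omega>\<bar> \<le> B * B'"
    by eventually_elim (fastforce simp: abs_mult intro!: mult_mono)
  then show ?case by auto
next
  case (Suc n)
  then obtain c G c' G' where cG: "bounded (c ` W)" "uniform_expansion n W G"
    "\<forall>\<^sub>F \<delta> in at_right 0. \<forall>\<omega>\<in>W. F \<delta> \<omega> = c \<omega> + \<delta> * G \<delta> \<omega>"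
    "bounded (c' ` W)" "uniform_expansion n W G'"
    "\<forall>\<^sub>F \<delta> in at_right 0. \<forall>\<omega>\<in>W. F' \<delta> \<omega> = c' \<omega> + \<delta> * G' \<delta> \<omega>" by auto
  \<comment> \<open>The product has a cross term with \<delta>^2. One \<delta> is left attached to
    \<open>G'\<close>, so that the induction hypothesis applies to the factors \<open>G\<close> and
    \<open>\<delta> * G'\<close>.\<close>
  let ?H = "\<lambda>\<delta> \<omega>. (c \<omega> * G' \<delta> \<omega> + c' \<omega> * G \<delta> \<omega>) + G \<delta> \<omega> * (\<delta> * G' \<delta> \<omega>)"
  from cG(3,6) have "\<forall>\<^sub>F \<delta> in at_right 0. \<forall>\<omega>\<in>W.
     F \<delta> \<omega> * F' \<delta> \<omega> = (c \<omega> * c' \<omega>) + \<delta> * ?H \<delta> \<omega>"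
    by eventually_elim (auto simp: algebra_simps)
  moreover have "uniform_expansion n W ?H"
    by (intro uniform_expansion_add Suc.IH uniform_expansion_const cG
         uniform_expansion_Suc_D[OF uniform_expansion_delta_mult])
  moreover have "bounded ((\<lambda>\<omega>. c \<omega> * c' \<omega>) ` W)"
  proof -
    from cG obtain C C' where "\<And>\<omega>. \<omega>\<in>W \<Longrightarrow> \<bar>c \<omega>\<bar> \<le> C" "\<And>\<omega>. \<omega>\<in>W \<Longrightarrow> \<bar>c' \<omega>\<bar> \<le> C'"
      by (auto simp: bounded_iff)
    then have "\<bar>c \<omega> * c' \<omega>\<bar> \<le> C * C'" if "\<omega>\<in>W" for \<omega>
      unfolding abs_mult using that by (intro mult_mono) fastforce+
    then show ?thesis by (auto simp: bounded_iff)
  qed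
  ultimately show ?case unfolding uniform_expansion.simps by blast
qed

lemma uniform_expansion_real_const [simp]: "uniform_expansion n W (\<lambda>\<delta> \<omega>. a)"
  by (rule uniform_expansion_const) (simp add: image_constant_conv)

lemma uniform_expansion_delta: "uniform_expansion n W (\<lambda>\<delta> \<omega>. \<delta>)"
  using uniform_expansion_Suc_D[OF uniform_expansion_delta_mult[of n W "\<lambda>_ _. 1"]] by simp

lemma uniform_expansion_power:
  "uniform_expansion n W F \<Longrightarrow> uniform_expansion n W (\<lambda>\<delta> \<omega>. F \<delta> \<omega> ^ k)"
  by (induction k) (auto intro: uniform_expansion_mult)

lemma uniform_expansion_sum:
  assumes "\<And>i. i \<in> I \<Longrightarrow> uniform_expansion n W (F i)"
  shows "uniform_expansion n W (\<lambda>\<delta> \<omega>. \<Sum>i\<in>I. F i \<delta> \<omega>)"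
proof (cases "finite I")
  case True
  then show ?thesis using assms by induction (auto intro: uniform_expansion_add)
qed simp

text \<open>The entry point for Taylor estimates: a polynomial part plus \<open>\<delta> ^ n\<close>
  times a quotient that is merely bounded has an expansion of order \<open>n\<close>.\<close>

lemma uniform_expansion_delta_power_mult:
  assumes "uniform_expansion 0 W F"
  shows "uniform_expansion n W (\<lambda>\<delta> \<omega>. \<delta> ^ n * F \<delta> \<omega>)"
proof (induction n)
  case (Suc n)
  show ?case using uniform_expansion_delta_mult[OF Suc] by (simp add: mult.assoc)
qed (use assms in simp)

lemma uniform_expansion_tendsto:
  assumes F: "\<forall>\<^sub>F \<delta> in at_right 0. \<forall>\<omega>\<in>W. F \<delta> \<omega> = c \<omega> + \<delta> * G \<delta> \<omega>"
    and G: "uniform_expansion n W G" and w: "\<omega> \<in> W"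
  shows "((\<lambda>\<delta>. F \<delta> \<omega>) \<longlongrightarrow> c \<omega>) (at_right 0)"
proof -
  from uniform_expansion_imp_bounded[OF G]
  obtain B where B: "\<forall>\<^sub>F \<delta> in at_right 0. \<forall>\<omega>\<in>W. \<bar>G \<delta> \<omega>\<bar> \<le> B" by auto
  have "((\<lambda>\<delta>. G \<delta> \<omega> * \<delta>) \<longlongrightarrow> 0) (at_right 0)"
    by (rule Lim_null_comparison[where g = "\<lambda>\<delta>. B * \<bar>\<delta>\<bar>"])
       (use B w in \<open>auto elim!: eventually_mono simp: abs_mult intro!: mult_right_mono tendsto_eq_intros\<close>)
  then have "((\<lambda>\<delta>. c \<omega> + \<delta> * G \<delta> \<omega>) \<longlongrightarrow> c \<omega>) (at_right 0)"
    using tendsto_add[OF tendsto_const] by (fastforce simp: mult.commute)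
  then show ?thesis
    by (rule Lim_transform_eventually) (use F w in \<open>auto elim!: eventually_mono\<close>)
qed

text \<open>The coefficients in \<open>uniform_expansion\<close> are existential. They are limits,
  hence unique, so a known pointwise limit can replace the witness and the remainder becomes an
  explicit difference quotient.\<close>

lemma uniform_expansion_quotient:
  assumes F: "uniform_expansion (Suc n) W F"
    and lim: "\<And>\<omega>. \<omega> \<in> W \<Longrightarrow> ((\<lambda>\<delta>. F \<delta> \<omega>) \<longlongrightarrow> c \<omega>) (at_right 0)"
  shows "uniform_expansion n W (\<lambda>\<delta> \<omega>. (F \<delta> \<omega> - c \<omega>) / \<delta>)" "bounded (c ` W)"
proof -
  from F obtain d G where dG: "bounded (d ` W)" "uniform_expansion n W G"
    "\<forall>\<^sub>F \<delta> in at_right 0. \<forall>\<omega>\<in>W. F \<delta> \<omega> = d \<omega> + \<delta> * G \<delta> \<omega>" by auto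
  have eq: "d \<omega> = c \<omega>" if "\<omega> \<in> W" for \<omega>
    using tendsto_unique[OF _ uniform_expansion_tendsto[OF dG(3,2) that] lim[OF that]] by simp
  from dG(3) eventually_at_right_0_bounds
  have "\<forall>\<^sub>F \<delta> in at_right 0. \<forall>\<omega>\<in>W. (F \<delta> \<omega> - c \<omega>) / \<delta> = G \<delta> \<omega>"
    by eventually_elim (auto simp: eq)
  then show "uniform_expansion n W (\<lambda>\<delta> \<omega>. (F \<delta> \<omega> - c \<omega>) / \<delta>)"
    by (rule uniform_expansion_cong[OF dG(2)])
  show "bounded (c ` W)" using dG(1) eq by (metis image_cong)
qed

section \<open>Termwise integration and the criterion for the growth index\<close>

lemma uniform_expansion_integral:
  assumes M: "finite_measure M"
    and F: "uniform_expansion n (space M) F"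
    and meas: "\<And>\<delta>. 0 < \<delta> \<Longrightarrow> F \<delta> \<in> borel_measurable M"
  shows "uniform_expansion n (UNIV :: unit set) (\<lambda>\<delta> _. integral\<^sup>L M (F \<delta>))"
  using F meas
proof (induction n arbitrary: F)
  case 0
  interpret finite_measure M by fact
  from 0 obtain B where B: "\<forall>\<^sub>F \<delta> in at_right 0. \<forall>\<omega>\<in>space M. \<bar>F \<delta> \<omega>\<bar> \<le> B" by auto
  from B have "\<forall>\<^sub>F \<delta> in at_right 0. \<bar>integral\<^sup>L M (F \<delta>)\<bar> \<le> \<bar>B\<bar> * measure M (space M)"
  proof eventually_elim
    case (elim \<delta>)
    show ?case
    proof (cases "integrable M (F \<delta>)")
      case True
      have "\<bar>integral\<^sup>L M (F \<delta>)\<bar> \<le> (\<integral>\<omega>. \<bar>F \<delta> \<omega>\<bar> \<partial>M)"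
        by (rule integral_abs_bound)
      also have "\<dots> \<le> (\<integral>\<omega>. \<bar>B\<bar> \<partial>M)"
        by (rule integral_mono) (use True elim in \<open>force+\<close>)
      finally have "\<bar>integral\<^sup>L M (F \<delta>)\<bar> \<le> (\<integral>\<omega>. \<bar>B\<bar> \<partial>M)" .
      then show ?thesis by (simp add: mult.commute)
    next
      \<comment> \<open>A non-integrable function has integral 0 by convention, so the bound still
        holds.\<close>
      case False
      then show ?thesis by (simp add: not_integrable_integral_eq)
    qed
  qed
  then show ?case by auto
next
  case (Suc n)
  interpret finite_measure M by fact
  from Suc.prems obtain c G where cG: "bounded (c ` space M)" "uniform_expansion n (space M) G"
    "\<forall>\<^sub>F \<delta> in at_right 0. \<forall>\<omega>\<in>space M. F \<delta> \<omega> = c \<omega> + \<delta> * G \<delta> \<omega>" by auto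
  note lim = uniform_expansion_tendsto[OF cG(3,2)]
  \<comment> \<open>\<open>G\<close> is an arbitrary witness and may fail to be measurable. The
    literal difference quotient \<open>H\<close> agrees with it for small \<delta> > 0 and inherits
    measurability from \<open>F\<close> and \<open>c\<close>.\<close>
  define H where "H = (\<lambda>\<delta> \<omega>. (F \<delta> \<omega> - c \<omega>) / \<delta>)"
  have seq: "filterlim (\<lambda>n. 1 / real (Suc n)) (at_right 0) sequentially"
    by real_asymp
  \<comment> \<open>The coefficient is measurable as a pointwise limit of \<open>F\<close> along
    \<delta> = 1 / (n + 1).\<close>
  have cm: "c \<in> borel_measurable M"
  proof (rule borel_measurable_LIMSEQ_real)
    fix \<omega> assume "\<omega> \<in> space M"
    from filterlim_compose[OF lim[OF this] seq]
    show "(\<lambda>n. F (1 / real (Suc n)) \<omega>) \<longlonglongrightarrow> c \<omega>" .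
  qed (rule Suc.prems, simp)
  have Hm: "H \<delta> \<in> borel_measurable M" if "0 < \<delta>" for \<delta>
    unfolding H_def using Suc.prems(2)[OF that] cm by simp
  have HE: "uniform_expansion n (space M) H"
    unfolding H_def by (rule uniform_expansion_quotient[OF Suc.prems(1) lim])
  from uniform_expansion_imp_bounded[OF HE]
  obtain B where B: "\<forall>\<^sub>F \<delta> in at_right 0. \<forall>\<omega>\<in>space M. \<bar>H \<delta> \<omega>\<bar> \<le> B" by auto
  from cG(1) obtain C where C: "\<And>\<omega>. \<omega> \<in> space M \<Longrightarrow> \<bar>c \<omega>\<bar> \<le> C"
    by (auto simp: bounded_iff)
  have ci: "integrable M c"
    by (rule integrable_const_bound[where B = C]) (use C cm in auto)
  from B eventually_at_right_0_bounds
  have "\<forall>\<^sub>F \<delta> in at_right 0. integral\<^sup>L M (F \<delta>) = integral\<^sup>L M c + \<delta> * integral\<^sup>L M (H \<delta>)"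
  proof eventually_elim
    case (elim \<delta>)
    have Hi: "integrable M (H \<delta>)"
      by (rule integrable_const_bound[where B = B]) (use elim Hm in auto)
    have "F \<delta> = (\<lambda>\<omega>. c \<omega> + \<delta> * H \<delta> \<omega>)" using elim by (auto simp: H_def)
    then have "integral\<^sup>L M (F \<delta>) = integral\<^sup>L M (\<lambda>\<omega>. c \<omega> + \<delta> * H \<delta> \<omega>)" by simp
    also have "\<dots> = integral\<^sup>L M c + \<delta> * integral\<^sup>L M (H \<delta>)" using ci Hi by simp
    finally show ?case .
  qed
  then show ?case unfolding uniform_expansion.simps
    by (intro exI[of _ "\<lambda>_. integral\<^sup>L M c"] exI[of _ "\<lambda>\<delta> _. integral\<^sup>L M (H \<delta>)"])
       (use Suc.IH[OF HE Hm] in auto)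
qed

lemma unit_expansion_tendsto_Lim:
  assumes "uniform_expansion (Suc n) (UNIV :: unit set) (\<lambda>\<delta> _. J \<delta>)"
  shows "(J \<longlongrightarrow> Lim (at_right 0) J) (at_right 0)"
proof -
  from assms obtain c G where "uniform_expansion n (UNIV :: unit set) G"
    "\<forall>\<^sub>F \<delta> in at_right 0. \<forall>\<omega>\<in>(UNIV::unit set). J \<delta> = c \<omega> + \<delta> * G \<delta> \<omega>" by auto
  from uniform_expansion_tendsto[OF this(2,1)] have "(J \<longlongrightarrow> c ()) (at_right 0)" by simp
  with tendsto_Lim[OF _ this] show ?thesis by simp
qed

text \<open>The parameter set \<open>unit\<close> stands for a function of \<delta> alone. Each
  order comes with its own witnesses, whereas the growth index needs one coefficient sequence for
  all orders. Iterating \<open>Q\<close>, the difference quotient at the limit, produces it; every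
  iterate has expansions of all orders because \<open>J\<close> does.\<close>

lemma unit_expansion_coefficients:
  assumes "\<And>n. uniform_expansion n (UNIV :: unit set) (\<lambda>\<delta> _. J \<delta>)"
  obtains c where "(J \<longlongrightarrow> c 0) (at_right 0)"
    "\<And>n. \<exists>B. \<forall>\<^sub>F \<delta> in at_right 0. \<bar>J \<delta> - (\<Sum>k<n. c k * \<delta> ^ k)\<bar> \<le> B * \<delta> ^ n"
proof -
  define Q where "Q = (\<lambda>J \<delta>. (J \<delta> - Lim (at_right 0) J) / \<delta> :: real)"
  define c where "c k = Lim (at_right 0) ((Q ^^ k) J)" for k
  have E: "uniform_expansion n (UNIV :: unit set) (\<lambda>\<delta> _. (Q ^^ k) J \<delta>)" for n k
  proof (induction k arbitrary: n)
    case (Suc k)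
    show ?case
      using uniform_expansion_quotient(1)[OF Suc unit_expansion_tendsto_Lim[OF Suc]]
      by (simp add: Q_def)
  qed (use assms in simp)
  have eq: "J \<delta> = (\<Sum>k<n. c k * \<delta> ^ k) + \<delta> ^ n * (Q ^^ n) J \<delta>" if "0 < \<delta>" for \<delta> n
  proof (induction n)
    case (Suc n)
    have "(Q ^^ n) J \<delta> = c n + \<delta> * (Q ^^ Suc n) J \<delta>"
      using that by (simp add: Q_def c_def)
    with Suc show ?case by (simp add: algebra_simps)
  qed simp
  have "\<exists>B. \<forall>\<^sub>F \<delta> in at_right 0. \<bar>J \<delta> - (\<Sum>k<n. c k * \<delta> ^ k)\<bar> \<le> B * \<delta> ^ n" for n
  proof -
    from E[of 0 n] obtain B where "\<forall>\<^sub>F \<delta> in at_right 0. \<bar>(Q ^^ n) J \<delta>\<bar> \<le> B" by auto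
    with eventually_at_right_0_bounds
    have "\<forall>\<^sub>F \<delta> in at_right 0. \<bar>J \<delta> - (\<Sum>k<n. c k * \<delta> ^ k)\<bar> \<le> B * \<delta> ^ n"
    proof eventually_elim
      case (elim \<delta>)
      then have "\<bar>\<delta> ^ n * (Q ^^ n) J \<delta>\<bar> \<le> B * \<delta> ^ n"
        by (simp add: abs_mult mult.commute mult_right_mono)
      then show ?case using eq[of \<delta> n] elim by simp
    qed
    then show ?thesis ..
  qed
  moreover have "(J \<longlongrightarrow> c 0) (at_right 0)"
    using unit_expansion_tendsto_Lim[OF assms] by (simp add: c_def)
  ultimately show ?thesis using that by blast
qed

text \<open>The lower bound \<kappa> passes to the limit and makes the coefficient of exponent m / q
  positive. The progression starts there, with step 1 / q, so no smaller exponent can occur.\<close>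

lemma has_growth_indexI:
  fixes f :: "real ^ 'n \<Rightarrow> real"
  assumes f: "admissible_phase f" and \<rho>: "0 < \<rho>" and q: "0 < q" and m: "0 < m"
    and J: "\<And>\<phi>. test_function \<rho> \<phi> \<Longrightarrow> \<exists>J \<kappa>.
      (\<forall>n. uniform_expansion n (UNIV :: unit set) (\<lambda>\<delta> _. J \<delta>)) \<and>
      0 < \<kappa> \<and> (\<forall>\<^sub>F \<delta> in at_right 0. \<kappa> \<le> J \<delta>) \<and>
      (\<forall>\<^sub>F \<delta> in at_right 0. sublevel_integral f \<phi> (\<delta> ^ q) = \<delta> ^ m * J \<delta>)"
  shows "has_growth_index f (real m / real q)"
proof -
  define r where "r j = (real m + real j) / real q" for j
  have r: "rational_progression r"
    unfolding rational_progression_def r_def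
    by (rule bexI[of _ "real m / real q"], rule bexI[of _ "1 / real q"])
       (use q m in \<open>auto simp: field_simps\<close>)
  have "\<exists>c. has_log_power_expansion (sublevel_integral f \<phi>) CARD('n) r c \<and>
          real m / real q \<in> {r j |i j. i < CARD('n) \<and> c i j \<noteq> 0} \<and>
          (\<forall>s \<in> {r j |i j. i < CARD('n) \<and> c i j \<noteq> 0}. real m / real q \<le> s)"
    if phi: "test_function \<rho> \<phi>" for \<phi>
  proof -
    from J[OF phi] obtain J \<kappa> where E: "\<And>n. uniform_expansion n (UNIV :: unit set) (\<lambda>\<delta> _. J \<delta>)"
      and \<kappa>: "0 < \<kappa>" "\<forall>\<^sub>F \<delta> in at_right 0. \<kappa> \<le> J \<delta>"
      and I: "\<forall>\<^sub>F \<delta> in at_right 0. sublevel_integral f \<phi> (\<delta> ^ q) = \<delta> ^ m * J \<delta>" by blast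
    from unit_expansion_coefficients[OF E] obtain d where d: "(J \<longlongrightarrow> d 0) (at_right 0)"
      "\<And>n. \<exists>B. \<forall>\<^sub>F \<delta> in at_right 0. \<bar>J \<delta> - (\<Sum>k<n. d k * \<delta> ^ k)\<bar> \<le> B * \<delta> ^ n" by blast
    have "\<kappa> \<le> d 0" using tendsto_lowerbound[OF d(1) \<kappa>(2)] by simp
    with \<kappa> have d0: "d 0 \<noteq> 0" by simp
    \<comment> \<open>No logarithms arise: only the coefficients with \<open>i = 0\<close> can
      differ from 0.\<close>
    define c where "c i j = (if i = 0 then d j else 0)" for i j :: nat
    have csum: "(\<Sum>i<CARD('n). c i j * ln \<epsilon> ^ i * \<epsilon> powr r j) = d j * \<epsilon> powr r j" for j \<epsilon>
    proof -
      have "(\<Sum>i<CARD('n). c i j * ln \<epsilon> ^ i * \<epsilon> powr r j) = (\<Sum>i\<in>{0}. c i j * ln \<epsilon> ^ i * \<epsilon> powr r j)"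
        by (rule sum.mono_neutral_right) (auto simp: c_def)
      then show ?thesis by (simp add: c_def)
    qed
    have "has_log_power_expansion (sublevel_integral f \<phi>) CARD('n) r c"
      unfolding has_log_power_expansion_def csum
    proof (intro allI landau_o.smallI)
      fix K :: nat and e :: real assume e: "0 < e"
      \<comment> \<open>One order more than asked for: an error bounded by
        \<open>B * \<delta> ^ Suc K\<close> is o(\<delta>^K).\<close>
      from d(2)[of "Suc K"] obtain B where B:
        "\<forall>\<^sub>F \<delta> in at_right 0. \<bar>J \<delta> - (\<Sum>k<Suc K. d k * \<delta> ^ k)\<bar> \<le> B * \<delta> ^ Suc K" by blast
      have "((\<lambda>\<delta>. B * \<delta>) \<longlongrightarrow> 0) (at_right 0)" by (auto intro!: tendsto_eq_intros)
      from order_tendstoD(2)[OF this e] have Be: "\<forall>\<^sub>F \<delta> in at_right 0. B * \<delta> < e" .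
      have lim: "filterlim (\<lambda>\<epsilon>::real. \<epsilon> powr (1 / real q)) (at_right 0) (at_right 0)"
        using q by real_asymp
      have "\<forall>\<^sub>F \<delta> in at_right 0. 0 < \<delta> \<and>
          \<bar>sublevel_integral f \<phi> (\<delta> ^ q) - (\<Sum>j\<le>K. d j * \<delta> ^ (m + j))\<bar> \<le> e * \<delta> ^ (m + K)"
        using I B Be eventually_at_right_0_bounds
      proof eventually_elim
        case (elim \<delta>)
        have "sublevel_integral f \<phi> (\<delta> ^ q) - (\<Sum>j\<le>K. d j * \<delta> ^ (m + j)) =
            \<delta> ^ m * (J \<delta> - (\<Sum>k<Suc K. d k * \<delta> ^ k))"
          using elim by (simp add: lessThan_Suc_atMost right_diff_distrib sum_distrib_left power_add ac_simps)
        also have "\<bar>\<dots>\<bar> = \<delta> ^ m * \<bar>J \<delta> - (\<Sum>k<Suc K. d k * \<delta> ^ k)\<bar>"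
          using elim by (simp add: abs_mult)
        also have "\<dots> \<le> \<delta> ^ m * (B * \<delta> ^ Suc K)"
          using elim by (intro mult_left_mono) auto
        also have "\<dots> = (B * \<delta>) * \<delta> ^ (m + K)" by (simp add: power_add)
        also have "\<dots> \<le> e * \<delta> ^ (m + K)" using elim by (intro mult_right_mono) auto
        finally show ?case using elim by simp
      qed
      from eventually_compose_filterlim[OF this lim] eventually_at_right_0_bounds
      show "\<forall>\<^sub>F \<epsilon> in at_right 0.
          norm (sublevel_integral f \<phi> \<epsilon> - (\<Sum>j\<le>K. d j * \<epsilon> powr r j)) \<le> e * norm (\<epsilon> powr r K)"
      proof eventually_elim
        case (elim \<epsilon>)
        have "(\<epsilon> powr (1 / real q)) ^ q = \<epsilon>"
          using elim q by (simp add: powr_realpow[symmetric] powr_powr)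
        moreover have "(\<epsilon> powr (1 / real q)) ^ (m + j) = \<epsilon> powr r j" for j
          using elim q by (simp add: powr_realpow[symmetric] powr_powr r_def)
        ultimately show ?case using elim by simp
      qed
    qed
    moreover have "real m / real q \<in> {r j |i j. i < CARD('n) \<and> c i j \<noteq> 0}"
      using d0 by (auto simp: r_def c_def intro!: exI[of _ 0])
    moreover have "\<forall>s \<in> {r j |i j. i < CARD('n) \<and> c i j \<noteq> 0}. real m / real q \<le> s"
      by (auto simp: r_def divide_right_mono)
    ultimately show ?thesis by blast
  qed
  with f \<rho> r show ?thesis unfolding has_growth_index_def by blast
qed

section \<open>Taylor expansion of smooth functions and of real powers\<close>

lemma smooth_partial: "smooth \<phi> \<Longrightarrow> smooth (\<lambda>x. frechet_derivative \<phi> (at x) v)"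
  unfolding smooth_def by (metis Ck.simps(2))

lemma smooth_differentiable: "smooth \<phi> \<Longrightarrow> \<phi> differentiable (at x)"
  unfolding smooth_def by (metis Ck.simps(2))

lemma smooth_continuous: "smooth \<phi> \<Longrightarrow> continuous_on UNIV \<phi>"
  unfolding smooth_def by (metis Ck.simps(1))

text \<open>The \<open>k\<close>-th derivative along \<open>p\<close>, expanded into partial derivatives so that it is visibly a
  polynomial in the coordinates of \<open>p\<close>.\<close>

fun directional_derivative ::
    "nat \<Rightarrow> ('a::euclidean_space \<Rightarrow> real) \<Rightarrow> 'a \<Rightarrow> 'a \<Rightarrow> real" where
  "directional_derivative 0 \<phi> p z = \<phi> z"
| "directional_derivative (Suc k) \<phi> p z =
     (\<Sum>b\<in>Basis. (p \<bullet> b) * directional_derivative k (\<lambda>x. frechet_derivative \<phi> (at x) b) p z)"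

lemma has_real_derivative_directional:
  assumes "smooth \<phi>"
  shows "((\<lambda>s. directional_derivative k \<phi> p (z + s *\<^sub>R p)) has_real_derivative
      directional_derivative (Suc k) \<phi> p (z + s *\<^sub>R p)) (at s)"
  using assms
proof (induction k arbitrary: \<phi>)
  case 0
  let ?D = "frechet_derivative \<phi> (at (z + s *\<^sub>R p))"
  have D: "(\<phi> has_derivative ?D) (at (z + s *\<^sub>R p))"
    using smooth_differentiable[OF 0] frechet_derivative_works by blast
  interpret linear ?D by (rule has_derivative_linear[OF D])
  have "((\<lambda>s. z + s *\<^sub>R p) has_derivative (\<lambda>h. h *\<^sub>R p)) (at s)"
    by (auto intro!: derivative_eq_intros)
  from has_derivative_compose[OF this D]
  have "((\<lambda>s. \<phi> (z + s *\<^sub>R p)) has_derivative (\<lambda>h. ?D (h *\<^sub>R p))) (at s)" .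
  moreover have "?D (h *\<^sub>R p) = h * (\<Sum>b\<in>Basis. (p \<bullet> b) * ?D b)" for h
  proof -
    have "?D p = ?D (\<Sum>b\<in>Basis. (p \<bullet> b) *\<^sub>R b)" by (simp add: euclidean_representation)
    then show ?thesis by (simp add: sum scale)
  qed
  then have "(\<lambda>h. ?D (h *\<^sub>R p)) = (*) (\<Sum>b\<in>Basis. (p \<bullet> b) * ?D b)"
    by (auto simp: fun_eq_iff mult.commute)
  ultimately show ?case by (simp add: has_field_derivative_def)
next
  case (Suc k)
  show ?case
    unfolding directional_derivative.simps(2)[of "Suc k"] directional_derivative.simps(2)[of k \<phi>]
    by (intro DERIV_sum DERIV_cmult Suc.IH smooth_partial Suc.prems)
qed

lemma directional_derivative_bounded:
  assumes "smooth (\<phi> :: 'a::euclidean_space \<Rightarrow> real)"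
  obtains C where "\<And>p z. norm p \<le> P \<Longrightarrow> norm z \<le> R \<Longrightarrow> \<bar>directional_derivative k \<phi> p z\<bar> \<le> C"
proof -
  have "\<exists>C. \<forall>p z. norm p \<le> P \<longrightarrow> norm z \<le> R \<longrightarrow> \<bar>directional_derivative k \<phi> p z\<bar> \<le> C"
    using assms
  proof (induction k arbitrary: \<phi>)
    case 0
    have "compact (\<phi> ` cball 0 R)"
      by (rule compact_continuous_image)
         (use smooth_continuous[OF 0] continuous_on_subset in \<open>blast, simp\<close>)
    then have "bounded (\<phi> ` cball 0 R)" by (rule compact_imp_bounded)
    then obtain A where "\<forall>x\<in>cball 0 R. \<bar>\<phi> x\<bar> \<le> A" by (auto simp: bounded_iff)
    then show ?case by (intro exI[of _ A]) auto
  next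
    case (Suc k)
    have "\<forall>b. \<exists>C. \<forall>p z. norm p \<le> P \<longrightarrow> norm z \<le> R \<longrightarrow>
        \<bar>directional_derivative k (\<lambda>x. frechet_derivative \<phi> (at x) b) p z\<bar> \<le> C"
      using Suc.IH[OF smooth_partial[OF Suc.prems]] by blast
    from choice[OF this] obtain C where C: "\<And>b p z. norm p \<le> P \<Longrightarrow> norm z \<le> R \<Longrightarrow>
        \<bar>directional_derivative k (\<lambda>x. frechet_derivative \<phi> (at x) b) p z\<bar> \<le> C b" by blast
    have "\<bar>directional_derivative (Suc k) \<phi> p z\<bar> \<le> (\<Sum>b\<in>Basis. P * C b)"
      if "norm p \<le> P" "norm z \<le> R" for p z
      unfolding directional_derivative.simps
    proof (rule sum_abs[THEN order_trans], rule sum_mono)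
      fix b :: 'a assume b: "b \<in> Basis"
      have "\<bar>p \<bullet> b\<bar> \<le> P" using Basis_le_norm[OF b, of p] that by simp
      then show "\<bar>p \<bullet> b * directional_derivative k (\<lambda>x. frechet_derivative \<phi> (at x) b) p z\<bar> \<le> P * C b"
        unfolding abs_mult using C[OF that, of b] by (intro mult_mono) auto
    qed
    then show ?case by blast
  qed
  then show ?thesis using that by blast
qed

lemma directional_derivative_scaleR:
  "directional_derivative k \<phi> (c *\<^sub>R p) z = c ^ k * directional_derivative k \<phi> p z"
  by (induction k arbitrary: \<phi>) (simp_all add: sum_distrib_left ac_simps)

lemma uniform_expansion_directional_derivative:
  assumes "\<And>b. b \<in> Basis \<Longrightarrow> uniform_expansion n W (\<lambda>\<delta> \<omega>. p \<delta> \<omega> \<bullet> b)"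
  shows "uniform_expansion n W (\<lambda>\<delta> \<omega>. directional_derivative k \<phi> (p \<delta> \<omega>) z)"
  by (induction k arbitrary: \<phi>)
     (auto intro!: uniform_expansion_sum uniform_expansion_mult assms)

text \<open>Taylor's formula along the segment from 0 to
  \<open>\<delta> *\<^sub>R p \<delta> \<omega>\<close>. Homogeneity extracts
  \<open>\<delta> ^ k\<close> from the k-th term and leaves a polynomial in the coordinates of
  \<open>p\<close>, which have expansions by assumption. For \<delta> < 1 the segment stays in a
  ball fixed by the bounds on \<open>p\<close>, where the n-th derivatives are bounded.\<close>

lemma uniform_expansion_smooth_compose:
  assumes phi: "smooth (\<phi> :: 'a::euclidean_space \<Rightarrow> real)"
    and p: "\<And>b. b \<in> Basis \<Longrightarrow> uniform_expansion n W (\<lambda>\<delta> \<omega>. p \<delta> \<omega> \<bullet> b)"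
  shows "uniform_expansion n W (\<lambda>\<delta> \<omega>. \<phi> (\<delta> *\<^sub>R p \<delta> \<omega>))"
proof -
  define S where "S = (\<lambda>\<delta> \<omega>. \<Sum>k<n. (1 / fact k) * (\<delta> ^ k * directional_derivative k \<phi> (p \<delta> \<omega>) 0))"
  have "\<forall>b\<in>Basis. \<exists>B. \<forall>\<^sub>F \<delta> in at_right 0. \<forall>\<omega>\<in>W. \<bar>p \<delta> \<omega> \<bullet> b\<bar> \<le> B"
    using uniform_expansion_imp_bounded[OF p] by simp
  from bchoice[OF this] obtain B where
    "\<And>b. b \<in> Basis \<Longrightarrow> \<forall>\<^sub>F \<delta> in at_right 0. \<forall>\<omega>\<in>W. \<bar>p \<delta> \<omega> \<bullet> b\<bar> \<le> B b" by blast
  then have "\<forall>\<^sub>F \<delta> in at_right 0. \<forall>b\<in>Basis. \<forall>\<omega>\<in>W. \<bar>p \<delta> \<omega> \<bullet> b\<bar> \<le> B b"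
    by (simp add: eventually_ball_finite_distrib)
  then have P: "\<forall>\<^sub>F \<delta> in at_right 0. \<forall>\<omega>\<in>W. norm (p \<delta> \<omega>) \<le> (\<Sum>b\<in>Basis. B b)"
    by eventually_elim (auto intro!: norm_le_l1[THEN order_trans] sum_mono)
  obtain C where C: "\<And>p z. norm p \<le> (\<Sum>b\<in>Basis. B b) \<Longrightarrow> norm z \<le> (\<Sum>b\<in>Basis. B b) \<Longrightarrow>
      \<bar>directional_derivative n \<phi> p z\<bar> \<le> C"
    using directional_derivative_bounded[OF phi] by blast
  have R: "\<forall>\<^sub>F \<delta> in at_right 0. \<forall>\<omega>\<in>W. \<bar>(\<phi> (\<delta> *\<^sub>R p \<delta> \<omega>) - S \<delta> \<omega>) / \<delta> ^ n\<bar> \<le> C"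
    using P eventually_at_right_0_bounds
  proof eventually_elim
    case (elim \<delta>)
    show ?case
    proof
      fix \<omega> assume w: "\<omega> \<in> W"
      let ?v = "\<delta> *\<^sub>R p \<delta> \<omega>"
      have "\<exists>t>0. t \<le> 1 \<and> directional_derivative 0 \<phi> ?v (0 + 1 *\<^sub>R ?v) =
         (\<Sum>k<n. directional_derivative k \<phi> ?v (0 + 0 *\<^sub>R ?v) / fact k * 1 ^ k) +
         directional_derivative n \<phi> ?v (0 + t *\<^sub>R ?v) / fact n * 1 ^ n"
        by (rule Maclaurin2[where f = "\<lambda>s. directional_derivative 0 \<phi> ?v (0 + s *\<^sub>R ?v)"
              and diff = "\<lambda>k s. directional_derivative k \<phi> ?v (0 + s *\<^sub>R ?v)"])
           (intro zero_less_one refl allI impI has_real_derivative_directional phi)+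
      then obtain t where t: "0 < t" "t \<le> 1" and "\<phi> ?v = (\<Sum>k<n. directional_derivative k \<phi> ?v 0 / fact k)
          + directional_derivative n \<phi> ?v (t *\<^sub>R ?v) / fact n" by auto
      then have eq: "\<phi> ?v - S \<delta> \<omega> = \<delta> ^ n * (directional_derivative n \<phi> (p \<delta> \<omega>) (t *\<^sub>R ?v) / fact n)"
        by (simp add: S_def directional_derivative_scaleR)
      \<comment> \<open>Both t and \<delta> are at most 1, so the intermediate point obeys the same
        bound as \<open>p \<delta> \<omega>\<close>.\<close>
      have "(t * \<delta>) * norm (p \<delta> \<omega>) \<le> 1 * norm (p \<delta> \<omega>)"
        using t elim by (intro mult_right_mono) (auto intro: mult_le_one)
      then have "norm (t *\<^sub>R ?v) \<le> (\<Sum>b\<in>Basis. B b)"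
        using elim w t by (force simp: abs_mult)
      then have "\<bar>directional_derivative n \<phi> (p \<delta> \<omega>) (t *\<^sub>R ?v)\<bar> \<le> C"
        using elim w by (intro C) auto
      moreover have "\<bar>x / fact n\<bar> \<le> \<bar>x\<bar>" for x :: real
        using mult_right_mono[OF fact_ge_1[of n, where 'a = real], of "\<bar>x\<bar>"]
          by (simp add: field_simps)
      ultimately show "\<bar>(\<phi> ?v - S \<delta> \<omega>) / \<delta> ^ n\<bar> \<le> C"
        using elim unfolding eq by (auto intro: order_trans)
    qed
  qed
  have SE: "uniform_expansion n W S" unfolding S_def
    by (intro uniform_expansion_sum uniform_expansion_mult uniform_expansion_real_const
      uniform_expansion_power uniform_expansion_delta uniform_expansion_directional_derivative p)
  have "uniform_expansion n W (\<lambda>\<delta> \<omega>. S \<delta> \<omega> + \<delta> ^ n * ((\<phi> (\<delta> *\<^sub>R p \<delta> \<omega>) - S \<delta> \<omega>) / \<delta> ^ n))"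
    by (intro uniform_expansion_add uniform_expansion_delta_power_mult SE) (use R in auto)
  then show ?thesis
    by (rule uniform_expansion_cong)
       (rule eventually_mono[OF eventually_at_right_0_bounds], simp)
qed

lemma powr_higher_derivative:
  assumes "0 < x"
  shows "((\<lambda>x. (\<Prod>i<m. a - real i) * x powr (a - real m)) has_real_derivative
     (\<Prod>i<Suc m. a - real i) * x powr (a - real (Suc m))) (at x)"
  using assms by (auto intro!: derivative_eq_intros simp: algebra_simps)

text \<open>Taylor's formula for the power at the common limit \<open>c\<close>. As \<open>c\<close>
  does not depend on \<omega>, all values of \<open>F\<close> lie in the compact interval from c/2
  to 3c/2 once \<delta> is small, away from the singularity at 0. One order is lost because the
  Taylor polynomial is written in \<open>\<delta> * G\<close>, where \<open>G\<close> is the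
  difference quotient of \<open>F\<close>.\<close>

lemma uniform_expansion_powr:
  assumes F: "uniform_expansion (Suc n) W F" and c: "0 < c"
    and lim: "\<And>\<omega>. \<omega> \<in> W \<Longrightarrow> ((\<lambda>\<delta>. F \<delta> \<omega>) \<longlongrightarrow> c) (at_right 0)"
  shows "uniform_expansion n W (\<lambda>\<delta> \<omega>. F \<delta> \<omega> powr a)"
proof -
  define G where "G = (\<lambda>\<delta> \<omega>. (F \<delta> \<omega> - c) / \<delta>)"
  have G: "uniform_expansion n W G"
    unfolding G_def by (rule uniform_expansion_quotient(1)[OF F lim])
  define D where "D m x = (\<Prod>i<m. a - real i) * x powr (a - real m)" for m x
  from uniform_expansion_imp_bounded[OF G]
  obtain B where B: "\<forall>\<^sub>F \<delta> in at_right 0. \<forall>\<omega>\<in>W. \<bar>G \<delta> \<omega>\<bar> \<le> B" by auto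
  have "continuous_on {c/2..3*c/2} (D n)"
    unfolding D_def using c by (auto intro!: continuous_intros)
  then have "bounded (D n ` {c/2..3*c/2})"
    by (intro compact_imp_bounded compact_continuous_image) auto
  then obtain C where "\<forall>x\<in>{c/2..3*c/2}. \<bar>D n x\<bar> \<le> C" by (auto simp: bounded_iff)
  then have C: "\<And>x. c/2 \<le> x \<Longrightarrow> x \<le> 3*c/2 \<Longrightarrow> \<bar>D n x\<bar> \<le> C" by auto
  define S where "S = (\<lambda>\<delta> \<omega>. \<Sum>m<n. (D m c / fact m) * (\<delta> * G \<delta> \<omega>) ^ m)"
  have "((\<lambda>\<delta>. B * \<delta>) \<longlongrightarrow> 0) (at_right 0)" by (auto intro!: tendsto_eq_intros)
  then have Be: "\<forall>\<^sub>F \<delta> in at_right 0. B * \<delta> < c / 2"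
    by (rule order_tendstoD) (use c in simp)
  have R: "\<forall>\<^sub>F \<delta> in at_right 0. \<forall>\<omega>\<in>W. \<bar>(F \<delta> \<omega> powr a - S \<delta> \<omega>) / \<delta> ^ n\<bar> \<le> C * \<bar>B\<bar> ^ n"
    using B Be eventually_at_right_0_bounds
  proof eventually_elim
    case (elim \<delta>)
    show ?case
    proof
      fix \<omega> assume w: "\<omega> \<in> W"
      let ?z = "\<delta> * G \<delta> \<omega>"
      have Fz: "F \<delta> \<omega> = c + ?z" using elim by (simp add: G_def)
      have "\<bar>?z\<bar> \<le> B * \<delta>" using elim w by (simp add: abs_mult mult.commute mult_right_mono)
      then have z: "\<bar>?z\<bar> \<le> c / 2" using elim by simp
      have "\<exists>t. \<bar>t\<bar> \<le> \<bar>?z\<bar> \<and> D 0 (c + ?z) =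
          (\<Sum>m<n. D m (c + 0) / fact m * ?z ^ m) + D n (c + t) / fact n * ?z ^ n"
      proof (rule Maclaurin_bi_le[where f = "\<lambda>z. D 0 (c + z)"], simp, intro allI impI)
        fix m t assume "m < n \<and> \<bar>t\<bar> \<le> \<bar>?z\<bar>"
        then have "0 < c + t" using z c by linarith
        then have "(D m has_real_derivative D (Suc m) (c + t)) (at (c + t))"
          unfolding D_def by (rule powr_higher_derivative)
        moreover have "((\<lambda>t. c + t) has_real_derivative 1) (at t)"
          by (auto intro!: derivative_eq_intros)
        ultimately show "((\<lambda>t. D m (c + t)) has_real_derivative D (Suc m) (c + t)) (at t)"
          using DERIV_chain2[where f = "D m" and g = "\<lambda>t. c + t" and x = t and s = UNIV and Db = 1]
          by simp
      qed
      then obtain t where t: "\<bar>t\<bar> \<le> \<bar>?z\<bar>"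
        and "(c + ?z) powr a = S \<delta> \<omega> + D n (c + t) / fact n * ?z ^ n"
        by (auto simp: D_def[of 0] S_def)
      then have eq: "F \<delta> \<omega> powr a - S \<delta> \<omega> = \<delta> ^ n * (D n (c + t) / fact n * G \<delta> \<omega> ^ n)"
        unfolding Fz by (simp add: power_mult_distrib)
      have "\<bar>D n (c + t)\<bar> \<le> C" using t z by (intro C) linarith+
      moreover have "\<bar>x / fact n\<bar> \<le> \<bar>x\<bar>" for x :: real
        using mult_right_mono[OF fact_ge_1[of n, where 'a = real], of "\<bar>x\<bar>"]
          by (simp add: field_simps)
      ultimately have "\<bar>D n (c + t) / fact n\<bar> \<le> C" by (meson order_trans)
      moreover from this have "0 \<le> C" by (meson abs_ge_zero order_trans)
      moreover have "\<bar>G \<delta> \<omega>\<bar> ^ n \<le> \<bar>B\<bar> ^ n" using elim w by (intro power_mono) force+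
      ultimately have "\<bar>D n (c + t) / fact n * G \<delta> \<omega> ^ n\<bar> \<le> C * \<bar>B\<bar> ^ n"
        unfolding abs_mult[of _ "_ ^ n"] power_abs by (intro mult_mono) auto
      then show "\<bar>(F \<delta> \<omega> powr a - S \<delta> \<omega>) / \<delta> ^ n\<bar> \<le> C * \<bar>B\<bar> ^ n"
        using elim unfolding eq by auto
    qed
  qed
  have SE: "uniform_expansion n W S" unfolding S_def
    by (intro uniform_expansion_sum uniform_expansion_mult uniform_expansion_real_const
      uniform_expansion_power uniform_expansion_delta G)
  have "uniform_expansion n W (\<lambda>\<delta> \<omega>. S \<delta> \<omega> + \<delta> ^ n * ((F \<delta> \<omega> powr a - S \<delta> \<omega>) / \<delta> ^ n))"
    by (intro uniform_expansion_add uniform_expansion_delta_power_mult SE) (use R in auto)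
  then show ?thesis
    by (rule uniform_expansion_cong)
       (rule eventually_mono[OF eventually_at_right_0_bounds], simp)
qed

section \<open>Integrals over parametrized sublevel sets\<close>

text \<open>Continuity of the transformed integrand makes it Borel measurable on \<open>W\<close>,
  which carries the identity from Lebesgue measure over to \<open>lborel\<close>.\<close>

lemma set_integral_change_of_variables:
  fixes T :: "real ^ 'm::{finite,wellorder} \<Rightarrow> real ^ 'm::_" and \<phi> :: "real ^ 'm::_ \<Rightarrow> real"
  assumes W: "W \<in> sets borel"
    and T: "\<And>x. x \<in> W \<Longrightarrow> (T has_derivative (*v) (A x)) (at x)" "inj_on T W"
    and phi: "set_integrable lborel (T ` W) \<phi>"
    and cont: "continuous_on W (\<lambda>x. \<bar>det (A x)\<bar> * \<phi> (T x))"
  shows "(LINT x:T ` W|lborel. \<phi> x) = (LINT x:W|lborel. \<bar>det (A x)\<bar> * \<phi> (T x))"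
proof -
  let ?D = "\<lambda>x. \<bar>det (A x)\<bar> * \<phi> (T x)"
  have abs: "\<phi> absolutely_integrable_on (T ` W)"
    using phi integrable_completion unfolding set_integrable_def
    by (metis borel_measurable_integrable)
  \<comment> \<open>The change of variables theorem concerns vector-valued integrands, so \<phi> is
    regarded as a map into \<open>real^1\<close>.\<close>
  have "(\<lambda>x. \<bar>det (matrix ((*v) (A x)))\<bar> *\<^sub>R vec (\<phi> (T x)) :: real^1) absolutely_integrable_on W \<and>
      integral W (\<lambda>x. \<bar>det (matrix ((*v) (A x)))\<bar> *\<^sub>R vec (\<phi> (T x)) :: real^1) = vec (integral (T ` W) \<phi>)"
    by (subst has_absolute_integral_change_of_variables[where f = "\<lambda>x. vec (\<phi> x)"])
       (use W T abs in \<open>auto intro: has_derivative_at_withinI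
          simp: absolutely_integrable_on_1_iff integral_on_1_eq\<close>)
  then have D: "?D absolutely_integrable_on W" "integral W ?D = integral (T ` W) \<phi>"
    by (auto simp: absolutely_integrable_on_1_iff integral_on_1_eq matrix_of_matrix_vector_mul vec_eq_iff)
  have "(LINT x:W|lborel. ?D x) = (LINT x:W|lebesgue. ?D x)"
    unfolding set_lebesgue_integral_def
    by (rule integral_completion[symmetric])
       (use borel_measurable_continuous_on_indicator[OF W cont] in simp)
  also have "\<dots> = integral W ?D" by (rule set_lebesgue_integral_eq_integral(2)[OF D(1)])
  also have "\<dots> = (LINT x:T ` W|lborel. \<phi> x)"
    using D(2) set_borel_integral_eq_integral(2)[OF phi] by simp
  finally show ?thesis by simp
qed

lemma has_derivative_componentwise_vec:
  fixes T :: "'a::real_normed_vector \<Rightarrow> real ^ 'm"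
  assumes "\<And>i. ((\<lambda>x. T x $ i) has_derivative (\<lambda>h. T' h $ i)) (at x)"
  shows "(T has_derivative T') (at x)"
  by (subst has_derivative_componentwise_within)
     (use assms in \<open>auto simp: Basis_vec_def inner_axis\<close>)

lemma test_function_integrable:
  assumes "test_function \<rho> \<phi>" "A \<in> sets borel"
  shows "set_integrable lborel A \<phi>"
proof -
  have cont: "continuous_on UNIV \<phi>" and supp: "closure {x. \<phi> x \<noteq> 0} \<subseteq> ball 0 \<rho>"
    using assms smooth_continuous by (auto simp: test_function_def)
  have "set_integrable lborel (cball 0 \<rho>) \<phi>"
    unfolding set_integrable_def
    by (rule borel_integrable_compact) (auto intro: continuous_on_subset[OF cont])
  moreover have "(\<lambda>x. indicator (cball 0 \<rho>) x *\<^sub>R \<phi> x) = \<phi>"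
    using supp closure_subset[of "{x. \<phi> x \<noteq> 0}"] by (fastforce simp: indicator_def fun_eq_iff)
  ultimately have "integrable lborel \<phi>" by (simp add: set_integrable_def)
  then show ?thesis
    unfolding set_integrable_def using assms(2) by (intro integrable_mult_indicator) auto
qed

text \<open>Positivity of the leading coefficient is obtained without computing it: the integrand is
  nonnegative on \<open>W\<close> and at least \<kappa> on one ball, so the integral stays above
  \<kappa> times the volume of that ball.\<close>

lemma set_integral_expansion:
  fixes F :: "real \<Rightarrow> 'a::euclidean_space \<Rightarrow> real"
  assumes W: "W \<in> sets borel" "bounded W"
    and F: "\<And>n. uniform_expansion n W F"
    and cont: "\<And>\<delta>. 0 < \<delta> \<Longrightarrow> continuous_on W (F \<delta>)"
    and nonneg: "\<forall>\<^sub>F \<delta> in at_right 0. \<forall>\<omega>\<in>W. 0 \<le> F \<delta> \<omega>"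
    and V: "ball \<omega>0 \<eta> \<subseteq> W" "0 < \<eta>" "0 < \<kappa>"
    and pos: "\<forall>\<^sub>F \<delta> in at_right 0. \<forall>\<omega>\<in>ball \<omega>0 \<eta>. \<kappa> \<le> F \<delta> \<omega>"
  shows "(\<forall>n. uniform_expansion n (UNIV :: unit set) (\<lambda>\<delta> _. LINT \<omega>:W|lborel. F \<delta> \<omega>)) \<and>
     0 < \<kappa> * measure lborel (ball \<omega>0 \<eta>) \<and>
     (\<forall>\<^sub>F \<delta> in at_right 0. \<kappa> * measure lborel (ball \<omega>0 \<eta>) \<le> (LINT \<omega>:W|lborel. F \<delta> \<omega>))"
proof (intro conjI allI)
  \<comment> \<open>Restriction to the bounded set \<open>W\<close> gives a finite measure with
    space \<open>W\<close>, the form in which \<open>uniform_expansion_integral\<close>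
    applies.\<close>
  let ?M = "restrict_space lborel W"
  have fin: "finite_measure ?M"
    by (rule finite_measureI)
       (use W emeasure_bounded_finite[OF W(2)] in \<open>auto simp: space_restrict_space emeasure_restrict_space\<close>)
  have meas: "F \<delta> \<in> borel_measurable ?M" if "0 < \<delta>" for \<delta>
    using borel_measurable_continuous_on_restrict[OF cont[OF that]]
    by (simp cong: measurable_cong_sets restrict_space_sets_cong)
  have int: "(LINT \<omega>:W|lborel. F \<delta> \<omega>) = integral\<^sup>L ?M (F \<delta>)" for \<delta>
    unfolding set_lebesgue_integral_def using W by (simp add: integral_restrict_space)
  have space: "space ?M = W" by (simp add: space_restrict_space)
  show "uniform_expansion n (UNIV :: unit set) (\<lambda>\<delta> _. LINT \<omega>:W|lborel. F \<delta> \<omega>)" for n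
    unfolding int by (rule uniform_expansion_integral[OF fin _ meas]) (simp_all add: space F)
  show "0 < \<kappa> * measure lborel (ball \<omega>0 \<eta>)"
    using V content_ball_pos[of \<eta> \<omega>0] by simp
  from F[of 0] obtain B where B: "\<forall>\<^sub>F \<delta> in at_right 0. \<forall>\<omega>\<in>W. \<bar>F \<delta> \<omega>\<bar> \<le> B" by auto
  show "\<forall>\<^sub>F \<delta> in at_right 0. \<kappa> * measure lborel (ball \<omega>0 \<eta>) \<le> (LINT \<omega>:W|lborel. F \<delta> \<omega>)"
    using B pos nonneg eventually_at_right_0_bounds
  proof eventually_elim
    case (elim \<delta>)
    interpret finite_measure ?M by fact
    have "integrable ?M (F \<delta>)"
      by (rule integrable_const_bound[where B = B]) (use elim meas space in auto)
    then have Fi: "integrable lborel (\<lambda>\<omega>. indicator W \<omega> *\<^sub>R F \<delta> \<omega>)"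
      using W by (simp add: integrable_restrict_space)
    have "\<kappa> * measure lborel (ball \<omega>0 \<eta>) = (\<integral>\<omega>. indicator (ball \<omega>0 \<eta>) \<omega> * \<kappa> \<partial>lborel)"
      by simp
    also have "\<dots> \<le> (\<integral>\<omega>. indicator W \<omega> *\<^sub>R F \<delta> \<omega> \<partial>lborel)"
    proof (rule integral_mono[OF _ Fi])
      show "integrable lborel (\<lambda>\<omega>. indicator (ball \<omega>0 \<eta>) \<omega> * \<kappa>)"
        by (intro integrable_mult_left integrable_real_indicator)
           (use emeasure_bounded_finite[OF bounded_ball, of \<omega>0 \<eta>] in auto)
      show "indicator (ball \<omega>0 \<eta>) \<omega> * \<kappa> \<le> indicator W \<omega> *\<^sub>R F \<delta> \<omega>" for \<omega>
        using elim V(1) by (auto simp: indicator_def)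
    qed
    finally show ?case by (simp add: set_lebesgue_integral_def)
  qed
qed

section \<open>Admissibility of the functions \<open>U t\<close>\<close>

lemma U_continuous: "continuous_on S (U t)"
  unfolding U_def by (intro continuous_intros)

lemma admissible_phase_U: "admissible_phase (U t)"
  unfolding admissible_phase_def
proof (intro conjI)
  \<comment> \<open>The multi-indices of the monomials x^4, x^2, y^2 and z^2.\<close>
  define S where "S = {\<lambda>i::3. if i = 1 then 4 else 0, \<lambda>i. if i = 1 then 2 else 0,
     \<lambda>i. if i = 2 then 2 else 0, \<lambda>i. if i = 3 then 2 else (0::nat)}"
  define c :: "(3 \<Rightarrow> nat) \<Rightarrow> real" where
    "c \<alpha> = (if \<alpha> \<notin> S then 0 else if \<alpha> = (\<lambda>i. if i = 1 then 2 else 0) then t else 1)" for \<alpha>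
  have prod3: "(\<Prod>i\<in>UNIV. f i) = f 1 * f 2 * f 3" for f :: "3 \<Rightarrow> real"
    unfolding UNIV_3 by (simp add: ac_simps)
  have "((\<lambda>\<alpha>. c \<alpha> * (\<Prod>i\<in>UNIV. (x $ i) ^ \<alpha> i)) has_sum U t x) UNIV" for x :: "real ^ 3"
  proof (rule has_sum_finite_neutralI[where B = S])
    show "U t x = (\<Sum>\<alpha>\<in>S. c \<alpha> * (\<Prod>i\<in>UNIV. (x $ i) ^ \<alpha> i))"
      unfolding S_def
      by (subst sum.insert | simp add: fun_eq_iff forall_3 prod3 c_def S_def U_def)+
  qed (auto simp: S_def c_def)
  then show "real_analytic_near_0 (U t)"
    unfolding real_analytic_near_0_def by (intro exI[of _ c] exI[of _ 1]) auto
  show "U t 0 = 0" by (simp add: U_def)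
  show "\<not> (\<forall>\<^sub>F x in nhds 0. U t x = 0)"
  proof
    assume "\<forall>\<^sub>F x in nhds 0. U t x = 0"
    then obtain d where d: "0 < d" "\<And>x. dist x 0 < d \<Longrightarrow> U t x = 0"
      by (auto simp: eventually_nhds_metric)
    \<comment> \<open>On the third axis \<open>U t\<close> equals z^2, whatever t is, so it is
      nonzero at points arbitrarily close to 0.\<close>
    have "U t (axis 3 (d / 2)) = 0" by (rule d(2)) (use d(1) in \<open>simp add: norm_eq_sqrt_inner inner_axis_axis real_sqrt_divide\<close>)
    then show False using d(1) by (simp add: U_def axis_def)
  qed
qed

section \<open>Quasi-homogeneous dilations\<close>

text \<open>Serves both t = 0 and t > 0. The factor \<delta> split off from the map sends all of
  \<open>W\<close> to 0 uniformly, so \<phi> at the image tends to \<open>\<phi> 0\<close> on the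
  whole of \<open>W\<close>, and a positive lower bound of the reduced Jacobian \<open>D\<close> is
  enough for positivity of the integral.\<close>

lemma has_growth_index_dilation:
  fixes f g :: "real ^ 'm::{finite,wellorder} \<Rightarrow> real" and p :: "real \<Rightarrow> real ^ 'm::_ \<Rightarrow> real ^ 'm::_"
  defines "W \<equiv> {\<omega>. 0 < g \<omega> \<and> g \<omega> < 1}"
  assumes f: "admissible_phase f" "continuous_on UNIV f" and q: "0 < q" and m: "0 < m"
    and g: "continuous_on UNIV g" "bounded W" "W \<noteq> {}"
    and fg: "\<And>\<delta> \<omega>. 0 < \<delta> \<Longrightarrow> f (\<delta> *\<^sub>R p \<delta> \<omega>) = \<delta> ^ q * g \<omega>"
    and bij: "\<And>\<delta>. 0 < \<delta> \<Longrightarrow> bij (\<lambda>\<omega>. \<delta> *\<^sub>R p \<delta> \<omega>)"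
    and deriv: "\<And>\<delta> \<omega>. 0 < \<delta> \<Longrightarrow> ((\<lambda>\<omega>. \<delta> *\<^sub>R p \<delta> \<omega>) has_derivative (*v) (A \<delta> \<omega>)) (at \<omega>)"
    and det: "\<And>\<delta> \<omega>. 0 < \<delta> \<Longrightarrow> \<bar>det (A \<delta> \<omega>)\<bar> = \<delta> ^ m * D \<delta> \<omega>"
    and p: "\<And>n i. uniform_expansion n W (\<lambda>\<delta> \<omega>. p \<delta> \<omega> $ i)"
    and D: "\<And>n. uniform_expansion n W D" "\<And>\<delta>. 0 < \<delta> \<Longrightarrow> continuous_on W (D \<delta>)"
    and d: "0 < d" "\<forall>\<^sub>F \<delta> in at_right 0. \<forall>\<omega>\<in>W. d \<le> D \<delta> \<omega>"
  shows "has_growth_index f (real m / real q)"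
proof (rule has_growth_indexI[where \<rho> = 1, OF f(1) _ q m])
  fix \<phi> :: "real ^ 'm::{finite,wellorder} \<Rightarrow> real" assume phi: "test_function 1 \<phi>"
  then have smooth: "smooth \<phi>" and nonneg: "\<And>x. 0 \<le> \<phi> x" and phi0: "0 < \<phi> 0"
    by (auto simp: test_function_def)
  let ?T = "\<lambda>\<delta> \<omega>. \<delta> *\<^sub>R p \<delta> \<omega>"
  define F where "F = (\<lambda>\<delta> \<omega>. D \<delta> \<omega> * \<phi> (?T \<delta> \<omega>))"
  have W: "open W" unfolding W_def Collect_conj_eq
    by (intro open_Int open_Collect_less continuous_on_const g(1))
  have phiT: "uniform_expansion n W (\<lambda>\<delta> \<omega>. \<phi> (?T \<delta> \<omega>))" for n
    by (rule uniform_expansion_smooth_compose[OF smooth])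
       (use p in \<open>auto simp: Basis_vec_def inner_axis\<close>)
  have lim: "((\<lambda>\<delta>. \<phi> (?T \<delta> \<omega>)) \<longlongrightarrow> \<phi> 0) (at_right 0)" if "\<omega> \<in> W" for \<omega>
  proof -
    have "((\<lambda>\<delta>. ?T \<delta> \<omega>) \<longlongrightarrow> 0) (at_right 0)"
    proof (rule vec_tendstoI)
      fix i
      have "((\<lambda>\<delta>. ?T \<delta> \<omega> $ i) \<longlongrightarrow> (\<lambda>_. 0) \<omega>) (at_right 0)"
        by (rule uniform_expansion_tendsto[OF _ p[of 0 i] that]) simp
      then show "((\<lambda>\<delta>. ?T \<delta> \<omega> $ i) \<longlongrightarrow> 0 $ i) (at_right 0)" by simp
    qed
    moreover have "isCont \<phi> 0"
      using smooth_continuous[OF smooth] by (simp add: continuous_on_eq_continuous_at)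
    ultimately show ?thesis by (rule isCont_tendsto_compose[rotated])
  qed
  \<comment> \<open>A bounded difference quotient upgrades the pointwise limit \<open>lim\<close> to
    convergence that is uniform on \<open>W\<close>.\<close>
  have "uniform_expansion 0 W (\<lambda>\<delta> \<omega>. (\<phi> (?T \<delta> \<omega>) - \<phi> 0) / \<delta>)"
    by (rule uniform_expansion_quotient(1)[OF phiT lim])
  then obtain B where B: "\<forall>\<^sub>F \<delta> in at_right 0. \<forall>\<omega>\<in>W. \<bar>(\<phi> (?T \<delta> \<omega>) - \<phi> 0) / \<delta>\<bar> \<le> B" by auto
  have "((\<lambda>\<delta>. B * \<delta>) \<longlongrightarrow> 0) (at_right 0)" by (auto intro!: tendsto_eq_intros)
  then have Be: "\<forall>\<^sub>F \<delta> in at_right 0. B * \<delta> < \<phi> 0 / 2"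
    by (rule order_tendstoD) (use phi0 in simp)
  have pos: "\<forall>\<^sub>F \<delta> in at_right 0. \<forall>\<omega>\<in>W. d * (\<phi> 0 / 2) \<le> F \<delta> \<omega>"
    using B Be d(2) eventually_at_right_0_bounds
  proof eventually_elim
    case (elim \<delta>)
    show ?case
    proof
      fix \<omega> assume w: "\<omega> \<in> W"
      have "\<bar>\<phi> (?T \<delta> \<omega>) - \<phi> 0\<bar> \<le> B * \<delta>"
        using elim w by (simp add: abs_divide pos_divide_le_eq)
      then have "\<phi> 0 / 2 \<le> \<phi> (?T \<delta> \<omega>)" using elim by linarith
      moreover have "d \<le> D \<delta> \<omega>" using elim w by blast
      ultimately show "d * (\<phi> 0 / 2) \<le> F \<delta> \<omega>"
        unfolding F_def using d(1) phi0 by (intro mult_mono) auto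
    qed
  qed
  obtain \<omega>0 \<eta> where ball: "0 < \<eta>" "ball \<omega>0 \<eta> \<subseteq> W"
    using g(3) W by (meson ex_in_conv openE)
  have contT: "continuous_on UNIV (?T \<delta>)" if "0 < \<delta>" for \<delta>
    by (intro continuous_at_imp_continuous_on ballI has_derivative_continuous[OF deriv[OF that]])
  have cont: "continuous_on W (F \<delta>)" if "0 < \<delta>" for \<delta>
  proof -
    have "continuous_on UNIV (\<lambda>\<omega>. \<phi> (?T \<delta> \<omega>))"
      by (rule continuous_on_compose2[OF smooth_continuous[OF smooth] contT[OF that]]) simp
    then have "continuous_on W (\<lambda>\<omega>. \<phi> (?T \<delta> \<omega>))" by (rule continuous_on_subset) simp
    then show ?thesis unfolding F_def by (rule continuous_on_mult[OF D(2)[OF that]])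
  qed
  have "(\<forall>n. uniform_expansion n (UNIV :: unit set) (\<lambda>\<delta> _. LINT \<omega>:W|lborel. F \<delta> \<omega>)) \<and>
     0 < d * (\<phi> 0 / 2) * measure lborel (ball \<omega>0 \<eta>) \<and>
     (\<forall>\<^sub>F \<delta> in at_right 0. d * (\<phi> 0 / 2) * measure lborel (ball \<omega>0 \<eta>) \<le> (LINT \<omega>:W|lborel. F \<delta> \<omega>))"
  proof (rule set_integral_expansion)
    show "uniform_expansion n W F" for n
      unfolding F_def by (intro uniform_expansion_mult D phiT)
    show "\<forall>\<^sub>F \<delta> in at_right 0. \<forall>\<omega>\<in>W. 0 \<le> F \<delta> \<omega>"
      using d(2) by eventually_elim (use d(1) nonneg in \<open>auto simp: F_def intro!: mult_nonneg_nonneg\<close>)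
    show "\<forall>\<^sub>F \<delta> in at_right 0. \<forall>\<omega>\<in>ball \<omega>0 \<eta>. d * (\<phi> 0 / 2) \<le> F \<delta> \<omega>"
      using pos by eventually_elim (use ball in auto)
  qed (use W g ball d phi0 cont in auto)
  moreover have "\<forall>\<^sub>F \<delta> in at_right 0. sublevel_integral f \<phi> (\<delta> ^ q) = \<delta> ^ m * (LINT \<omega>:W|lborel. F \<delta> \<omega>)"
    using eventually_at_right_0_bounds
  proof eventually_elim
    case (elim \<delta>)
    then have \<delta>: "0 < \<delta>" by simp
    let ?S = "{x. 0 < f x \<and> f x < \<delta> ^ q}"
    \<comment> \<open>\<open>W\<close> is the full preimage of the sublevel set, so surjectivity
      turns this into equality of the image.\<close>
    have img: "?T \<delta> ` W = ?S"
    proof -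
      have "0 < f (?T \<delta> \<omega>) \<and> f (?T \<delta> \<omega>) < \<delta> ^ q \<longleftrightarrow> \<omega> \<in> W" for \<omega>
        using \<delta> by (simp add: fg W_def zero_less_mult_iff mult_less_cancel_left1)
      then have "?T \<delta> -` ?S = W" by auto
      then show ?thesis using surj_image_vimage_eq[OF bij_is_surj[OF bij[OF \<delta>]], of ?S] by simp
    qed
    have S: "?S \<in> sets borel"
      unfolding Collect_conj_eq
      by (intro borel_open open_Int open_Collect_less continuous_on_const f(2))
    have eqF: "(\<lambda>\<omega>. \<bar>det (A \<delta> \<omega>)\<bar> * \<phi> (?T \<delta> \<omega>)) = (\<lambda>\<omega>. \<delta> ^ m * F \<delta> \<omega>)"
      using det[OF \<delta>] by (simp add: F_def mult.assoc)
    have "sublevel_integral f \<phi> (\<delta> ^ q) = (LINT x:?T \<delta> ` W|lborel. \<phi> x)"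
      by (simp add: sublevel_integral_def img)
    also have "\<dots> = (LINT \<omega>:W|lborel. \<bar>det (A \<delta> \<omega>)\<bar> * \<phi> (?T \<delta> \<omega>))"
    proof (rule set_integral_change_of_variables)
      show "inj_on (?T \<delta>) W"
        using bij_is_inj[OF bij[OF \<delta>]] by (rule inj_on_subset) simp
      show "set_integrable lborel (?T \<delta> ` W) \<phi>"
        unfolding img by (rule test_function_integrable[OF phi S])
      show "continuous_on W (\<lambda>\<omega>. \<bar>det (A \<delta> \<omega>)\<bar> * \<phi> (?T \<delta> \<omega>))"
        unfolding eqF by (intro continuous_intros cont \<delta>)
    qed (use W deriv[OF \<delta>] in auto)
    also have "\<dots> = \<delta> ^ m * (LINT \<omega>:W|lborel. F \<delta> \<omega>)"
      unfolding eqF by simp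
    finally show ?case .
  qed
  ultimately show "\<exists>J \<kappa>. (\<forall>n. uniform_expansion n (UNIV :: unit set) (\<lambda>\<delta> _. J \<delta>)) \<and>
      0 < \<kappa> \<and> (\<forall>\<^sub>F \<delta> in at_right 0. \<kappa> \<le> J \<delta>) \<and>
      (\<forall>\<^sub>F \<delta> in at_right 0. sublevel_integral f \<phi> (\<delta> ^ q) = \<delta> ^ m * J \<delta>)"
    by (intro exI[of _ "\<lambda>\<delta>. LINT \<omega>:W|lborel. F \<delta> \<omega>"]
          exI[of _ "d * (\<phi> 0 / 2) * measure lborel (ball \<omega>0 \<eta>)"]) (elim conjE, intro conjI)
qed simp

section \<open>The cases t = 0 and t > 0\<close>

lemma uniform_expansion_component:
  assumes "bounded W"
  shows "uniform_expansion n W (\<lambda>\<delta> \<omega>. \<omega> $ i)"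
  by (rule uniform_expansion_const) (rule bounded_linear_image[OF assms bounded_linear_vec_nth])

lemma power2_less_one_imp_abs: "x\<^sup>2 < 1 \<Longrightarrow> \<bar>x :: real\<bar> \<le> 1"
  by (meson abs_square_le_1 less_imp_le)

lemma bounded_vec3I:
  assumes "\<And>x :: real ^ 3. x \<in> W \<Longrightarrow> \<bar>x $ 1\<bar> \<le> a \<and> \<bar>x $ 2\<bar> \<le> b \<and> \<bar>x $ 3\<bar> \<le> c"
  shows "bounded W"
proof (rule boundedI)
  fix x assume "x \<in> W"
  with assms norm_le_l1_cart[of x] show "norm x \<le> a + b + c"
    by (force simp: sum_3)
qed

lemma has_derivative_diagonal3:
  fixes \<omega> :: "real ^ 3"
  assumes a: "(a has_real_derivative a') (at (\<omega> $ 1))"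
  shows "((\<lambda>\<omega>. vector [a (\<omega> $ 1), b * \<omega> $ 2, c * \<omega> $ 3] :: real ^ 3) has_derivative
    (*v) (vector [vector [a', 0, 0], vector [0, b, 0], vector [0, 0, c]])) (at \<omega>)"
proof (rule has_derivative_componentwise_vec)
  fix i :: 3
  have nth: "((\<lambda>\<omega>. \<omega> $ j) has_derivative (\<lambda>h. h $ j)) (at \<omega>)" for j :: 3
    by (rule bounded_linear_imp_has_derivative[OF bounded_linear_vec_nth])
  have "((\<lambda>\<omega>. a (\<omega> $ 1)) has_derivative (\<lambda>h. a' * h $ 1)) (at \<omega>)"
    using has_derivative_compose[OF nth a[unfolded has_field_derivative_def]] .
  then show "((\<lambda>\<omega>. (vector [a (\<omega> $ 1), b * \<omega> $ 2, c * \<omega> $ 3] :: real ^ 3) $ i) has_derivative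
      (\<lambda>h. (vector [vector [a', 0, 0], vector [0, b, 0], vector [0, 0, c]] *v h) $ i)) (at \<omega>)"
    using exhaust_3[of i]
    by (auto simp: matrix_vector_mult_def sum_3 intro!: has_derivative_mult_right nth)
qed

text \<open>The polynomial x^4 + y^2 + z^2 is quasi-homogeneous of degree 4 for the weights 1, 2, 2,
  and the Jacobian contributes 1 + 2 + 2 = 5. One factor \<delta> stands outside \<open>p\<close>,
  so \<open>p\<close> itself carries the weights 0, 1, 1.\<close>

lemma growth_index_U_0: "has_growth_index (U 0) (5 / 4)"
proof -
  define g where "g \<omega> = (\<omega> $ 1) ^ 4 + (\<omega> $ 2)\<^sup>2 + (\<omega> $ 3)\<^sup>2" for \<omega> :: "real ^ 3"
  define W where "W = {\<omega>. 0 < g \<omega> \<and> g \<omega> < 1}"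
  define p where "p \<delta> \<omega> = (vector [\<omega> $ 1, \<delta> * \<omega> $ 2, \<delta> * \<omega> $ 3] :: real ^ 3)"
    for \<delta> and \<omega> :: "real ^ 3"
  define A where "A \<delta> \<omega> = (vector [vector [\<delta>, 0, 0], vector [0, \<delta>\<^sup>2, 0], vector [0, 0, \<delta>\<^sup>2]] :: real ^ 3 ^ 3)"
    for \<delta> and \<omega> :: "real ^ 3"
  have bdd: "bounded W"
  proof (rule bounded_vec3I[where a = 1 and b = 1 and c = 1])
    fix x assume "x \<in> W"
    then have x: "(x $ 1) ^ 4 + (x $ 2)\<^sup>2 + (x $ 3)\<^sup>2 < 1" by (simp add: W_def g_def)
    have nn: "0 \<le> (x $ 1) ^ 4" "0 \<le> (x $ 2)\<^sup>2" "0 \<le> (x $ 3)\<^sup>2" by simp_all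
    have "((x $ 1)\<^sup>2)\<^sup>2 = (x $ 1) ^ 4" by (simp flip: power_mult)
    then have "((x $ 1)\<^sup>2)\<^sup>2 < 1" using x nn by linarith
    then have "(x $ 1)\<^sup>2 < 1" by (intro power2_less_imp_less[of _ 1]) auto
    moreover have "(x $ 2)\<^sup>2 < 1" "(x $ 3)\<^sup>2 < 1" using x nn by linarith+
    ultimately show "\<bar>x $ 1\<bar> \<le> 1 \<and> \<bar>x $ 2\<bar> \<le> 1 \<and> \<bar>x $ 3\<bar> \<le> 1"
      by (intro conjI power2_less_one_imp_abs)
  qed
  have "has_growth_index (U 0) (real 5 / real 4)"
  proof (rule has_growth_index_dilation[where g = g and p = p and A = A and D = "\<lambda>_ _. 1" and d = 1])
    show "continuous_on UNIV (U 0)" by (rule U_continuous)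
    show "continuous_on UNIV g" unfolding g_def by (intro continuous_intros)
    show "bounded {\<omega>. 0 < g \<omega> \<and> g \<omega> < 1}" using bdd by (simp add: W_def)
    have "axis 3 (1 / 2) \<in> {\<omega>. 0 < g \<omega> \<and> g \<omega> < 1}"
      by (simp add: g_def axis_def power_divide)
    then show "{\<omega>. 0 < g \<omega> \<and> g \<omega> < 1} \<noteq> {}" by blast
    fix \<delta> :: real assume \<delta>: "0 < \<delta>"
    show "U 0 (\<delta> *\<^sub>R p \<delta> \<omega>) = \<delta> ^ 4 * g \<omega>" for \<omega>
      by (simp add: U_def p_def g_def power2_eq_square power4_eq_xxxx algebra_simps)
    show "bij (\<lambda>\<omega>. \<delta> *\<^sub>R p \<delta> \<omega>)"
      by (rule bij_betw_byWitness[where f' = "\<lambda>x. vector [x $ 1 / \<delta>, x $ 2 / \<delta>\<^sup>2, x $ 3 / \<delta>\<^sup>2]"])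
         (use \<delta> in \<open>auto simp: p_def vec_eq_iff forall_3 power2_eq_square\<close>)
    show "((\<lambda>\<omega>. \<delta> *\<^sub>R p \<delta> \<omega>) has_derivative (*v) (A \<delta> \<omega>)) (at \<omega>)" for \<omega>
    proof -
      have "(\<lambda>\<omega>. \<delta> *\<^sub>R p \<delta> \<omega>) = (\<lambda>\<omega>. vector [\<delta> * \<omega> $ 1, \<delta>\<^sup>2 * \<omega> $ 2, \<delta>\<^sup>2 * \<omega> $ 3])"
        by (simp add: p_def fun_eq_iff vec_eq_iff forall_3 power2_eq_square)
      then show ?thesis unfolding A_def
        by (simp only:) (rule has_derivative_diagonal3, auto intro!: derivative_eq_intros)
    qed
    show "\<bar>det (A \<delta> \<omega>)\<bar> = \<delta> ^ 5 * 1" for \<omega>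
      using \<delta> by (simp add: A_def det_3 abs_mult eval_nat_numeral)
  next
    fix n i
    show "uniform_expansion n {\<omega>. 0 < g \<omega> \<and> g \<omega> < 1} (\<lambda>\<delta> \<omega>. p \<delta> \<omega> $ i)"
      unfolding W_def[symmetric] using exhaust_3[of i]
      by (auto simp: p_def intro!: uniform_expansion_component uniform_expansion_mult
           uniform_expansion_delta bdd)
  qed (auto intro: admissible_phase_U)
  then show ?thesis by simp
qed

lemma growth_index_U_pos:
  assumes t: "0 < t"
  shows "has_growth_index (U t) (3 / 2)"
proof -
  \<comment> \<open>These invert X = x sqrt (t + x^2): the number x^2 is the nonnegative root of u^2
    + t u = X^2, namely (S - t) / 2, so \<open>S X\<close> is t + 2 x^2 and \<open>M X\<close> is
    sqrt (t + x^2). Writing x as \<open>X / M X\<close> keeps the sign of X and avoids a square root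
    that degenerates at X = 0.\<close>
  define S where "S X = sqrt (t\<^sup>2 + 4 * X\<^sup>2)" for X :: real
  define M where "M X = sqrt ((t + S X) / 2)" for X :: real
  have arg: "0 < t\<^sup>2 + 4 * X\<^sup>2" for X :: real using t by (simp add: add_pos_nonneg)
  have S2: "(S X)\<^sup>2 = t\<^sup>2 + 4 * X\<^sup>2" for X using arg[of X] by (simp add: S_def)
  have St: "t \<le> S X" for X unfolding S_def by (rule real_le_rsqrt) simp
  have S: "0 < S X" for X using St[of X] t by linarith
  have M2: "(M X)\<^sup>2 = (t + S X) / 2" for X using S[of X] t by (simp add: M_def)
  have M: "0 < M X" for X using S[of X] t by (simp add: M_def)
  have X2: "4 * X\<^sup>2 = (S X - t) * (S X + t)" for X
    using S2[of X] by (simp add: algebra_simps power2_eq_square)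
  have xi2: "(X / M X)\<^sup>2 = (S X - t) / 2" for X
    using X2[of X] S[of X] t by (simp add: power_divide M2 field_simps)
  have DS: "(S has_real_derivative 4 * X / S X) (at X)" for X
    unfolding S_def using arg[of X] by (auto intro!: derivative_eq_intros simp: field_simps)
  have DM: "(M has_real_derivative X / (M X * S X)) (at X)" for X
    unfolding M_def using S[of X] t by (auto intro!: derivative_eq_intros DS simp: field_simps)
  \<comment> \<open>Since dX / dx = (t + 2 x^2) / sqrt (t + x^2) = S / M, the inverse has derivative
    M / S.\<close>
  have Dxi: "((\<lambda>X. X / M X) has_real_derivative M X / S X) (at X)" for X
  proof -
    have M4: "(M X)\<^sup>2 * S X - X\<^sup>2 = ((M X)\<^sup>2)\<^sup>2"
      using X2[of X] unfolding M2 by (simp add: field_simps power2_eq_square)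
    have "((\<lambda>X. X / M X) has_real_derivative (1 * M X - X * (X / (M X * S X))) / (M X * M X)) (at X)"
      by (intro DERIV_divide DERIV_ident DM) (use M[of X] in simp)
    moreover have "(1 * M X - X * (X / (M X * S X))) / (M X * M X) = ((M X)\<^sup>2 * S X - X\<^sup>2) / ((M X) ^ 3 * S X)"
      using M[of X] S[of X] by (simp add: field_simps power2_eq_square power3_eq_cube)
    moreover have "\<dots> = M X / S X"
      unfolding M4 using M[of X] S[of X] by (simp add: field_simps power2_eq_square power3_eq_cube)
    ultimately show ?thesis by simp
  qed
  define g where "g \<omega> = (\<omega> $ 1)\<^sup>2 + (\<omega> $ 2)\<^sup>2 + (\<omega> $ 3)\<^sup>2" for \<omega> :: "real ^ 3"
  define W where "W = {\<omega>. 0 < g \<omega> \<and> g \<omega> < 1}"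
  define p where "p \<delta> \<omega> = (vector [\<omega> $ 1 / M (\<delta> * \<omega> $ 1), \<omega> $ 2, \<omega> $ 3] :: real ^ 3)"
    for \<delta> and \<omega> :: "real ^ 3"
  define D where "D \<delta> \<omega> = M (\<delta> * \<omega> $ 1) / S (\<delta> * \<omega> $ 1)" for \<delta> and \<omega> :: "real ^ 3"
  define A where "A \<delta> \<omega> = (vector [vector [\<delta> * D \<delta> \<omega>, 0, 0], vector [0, \<delta>, 0], vector [0, 0, \<delta>]] :: real ^ 3 ^ 3)"
    for \<delta> and \<omega> :: "real ^ 3"
  have W1: "\<bar>x $ 1\<bar> \<le> 1 \<and> \<bar>x $ 2\<bar> \<le> 1 \<and> \<bar>x $ 3\<bar> \<le> 1" if "x \<in> W" for x
  proof -
    from that have x: "(x $ 1)\<^sup>2 + (x $ 2)\<^sup>2 + (x $ 3)\<^sup>2 < 1" by (simp add: W_def g_def)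
    have nn: "0 \<le> (x $ 1)\<^sup>2" "0 \<le> (x $ 2)\<^sup>2" "0 \<le> (x $ 3)\<^sup>2" by simp_all
    have "(x $ 1)\<^sup>2 < 1" "(x $ 2)\<^sup>2 < 1" "(x $ 3)\<^sup>2 < 1" using x nn by linarith+
    then show ?thesis by (intro conjI power2_less_one_imp_abs)
  qed
  then have bdd: "bounded W" by (rule bounded_vec3I)
  have Slim: "((\<lambda>\<delta>. S (\<delta> * u)) \<longlongrightarrow> t) (at_right 0)" for u
    unfolding S_def using t by (auto intro!: tendsto_eq_intros)
  have Mlim: "((\<lambda>\<delta>. (t + S (\<delta> * u)) / 2) \<longlongrightarrow> t) (at_right 0)" for u
    by (auto intro!: tendsto_eq_intros Slim)
  have argE: "uniform_expansion n W (\<lambda>\<delta> \<omega>. t\<^sup>2 + 4 * (\<delta> * \<omega> $ 1)\<^sup>2)" for n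
    by (intro uniform_expansion_add uniform_expansion_mult uniform_expansion_power
          uniform_expansion_real_const uniform_expansion_delta uniform_expansion_component bdd)
  have arglim: "((\<lambda>\<delta>. t\<^sup>2 + 4 * (\<delta> * u)\<^sup>2) \<longlongrightarrow> t\<^sup>2) (at_right 0)" for u
    by (auto intro!: tendsto_eq_intros)
  \<comment> \<open>Nested square roots call for two applications of
    \<open>uniform_expansion_powr\<close>, here for \<open>S\<close> and below for \<open>M\<close>.
    The limits t^2 and t are the same for all points of \<open>W\<close>, as that lemma requires;
    the exponent -1/2 supplies the reciprocals.\<close>
  have argpow: "uniform_expansion n W (\<lambda>\<delta> \<omega>. (t\<^sup>2 + 4 * (\<delta> * \<omega> $ 1)\<^sup>2) powr a)" for n a
    by (rule uniform_expansion_powr[OF argE _ arglim]) (use t in simp)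
  have "S (\<delta> * u) = (t\<^sup>2 + 4 * (\<delta> * u)\<^sup>2) powr (1 / 2)" for \<delta> u
    using arg[of "\<delta> * u"] by (simp add: S_def powr_half_sqrt)
  then have SE: "uniform_expansion n W (\<lambda>\<delta> \<omega>. S (\<delta> * \<omega> $ 1))" for n
    using argpow by simp
  have "uniform_expansion n W (\<lambda>\<delta> \<omega>. (1 / 2) * (t + S (\<delta> * \<omega> $ 1)))" for n
    by (intro uniform_expansion_add uniform_expansion_mult uniform_expansion_real_const SE)
  then have ME: "uniform_expansion n W (\<lambda>\<delta> \<omega>. (t + S (\<delta> * \<omega> $ 1)) / 2)" for n
    by simp
  have Mpow: "uniform_expansion n W (\<lambda>\<delta> \<omega>. ((t + S (\<delta> * \<omega> $ 1)) / 2) powr a)" for n a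
    by (rule uniform_expansion_powr[OF ME t Mlim])
  have Meq: "M X = ((t + S X) / 2) powr (1 / 2)" for X
    using S[of X] t by (simp add: M_def powr_half_sqrt)
  have Minv: "1 / M X = ((t + S X) / 2) powr (- (1 / 2))" for X
    unfolding Meq by (simp add: powr_minus_divide)
  have Sinv: "1 / S X = (t\<^sup>2 + 4 * X\<^sup>2) powr (- (1 / 2))" for X
    using arg[of X] by (simp add: S_def powr_half_sqrt powr_minus_divide)
  have "has_growth_index (U t) (real 3 / real 2)"
  proof (rule has_growth_index_dilation[where g = g and p = p and A = A and D = D
        and d = "sqrt t / sqrt (t\<^sup>2 + 4)"])
    show "continuous_on UNIV (U t)" by (rule U_continuous)
    show "continuous_on UNIV g" unfolding g_def by (intro continuous_intros)
    show "bounded {\<omega>. 0 < g \<omega> \<and> g \<omega> < 1}" using bdd by (simp add: W_def)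
    have "axis 3 (1 / 2) \<in> {\<omega>. 0 < g \<omega> \<and> g \<omega> < 1}"
      by (simp add: g_def axis_def power_divide)
    then show "{\<omega>. 0 < g \<omega> \<and> g \<omega> < 1} \<noteq> {}" by blast
    \<comment> \<open>This constant bounds \<open>D\<close> = M / S from below on \<open>W\<close>
      for \<delta> < 1: M is at least sqrt t, and S is at most sqrt (t^2 + 4) because its argument
      is at most 1 in absolute value.\<close>
    show "0 < sqrt t / sqrt (t\<^sup>2 + 4)" using t by (simp add: add_pos_nonneg)
    fix \<delta> :: real assume \<delta>: "0 < \<delta>"
    have Teq: "(\<lambda>\<omega>. \<delta> *\<^sub>R p \<delta> \<omega>) = (\<lambda>\<omega>. vector [\<delta> * \<omega> $ 1 / M (\<delta> * \<omega> $ 1), \<delta> * \<omega> $ 2, \<delta> * \<omega> $ 3])"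
      by (simp add: p_def fun_eq_iff vec_eq_iff forall_3)
    show "U t (\<delta> *\<^sub>R p \<delta> \<omega>) = \<delta> ^ 2 * g \<omega>" for \<omega>
    proof -
      let ?X = "\<delta> * \<omega> $ 1" and ?x = "\<delta> * \<omega> $ 1 / M (\<delta> * \<omega> $ 1)"
      have "?x ^ 4 + t * ?x\<^sup>2 = ?x\<^sup>2 * (?x\<^sup>2 + t)"
        by (simp add: algebra_simps power2_eq_square power4_eq_xxxx)
      also have "\<dots> = ?X\<^sup>2"
        unfolding xi2 using X2[of ?X] by (simp add: field_simps)
      finally show ?thesis
        unfolding fun_cong[OF Teq] by (simp add: U_def g_def algebra_simps power_mult_distrib)
    qed
    show "bij (\<lambda>\<omega>. \<delta> *\<^sub>R p \<delta> \<omega>)"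
    proof (rule bij_betw_byWitness[where f' = "\<lambda>x. vector [x $ 1 * sqrt (t + (x $ 1)\<^sup>2) / \<delta>, x $ 2 / \<delta>, x $ 3 / \<delta>]"])
      have "X / M X * sqrt (t + (X / M X)\<^sup>2) = X" for X
      proof -
        have "t + (X / M X)\<^sup>2 = (M X)\<^sup>2" unfolding xi2 M2 by (simp add: field_simps)
        then show ?thesis using M[of X] by simp
      qed
      from this[of "\<delta> * _"] show "\<forall>\<omega>\<in>UNIV. vector [(\<delta> *\<^sub>R p \<delta> \<omega>) $ 1 * sqrt (t + ((\<delta> *\<^sub>R p \<delta> \<omega>) $ 1)\<^sup>2) / \<delta>,
          (\<delta> *\<^sub>R p \<delta> \<omega>) $ 2 / \<delta>, (\<delta> *\<^sub>R p \<delta> \<omega>) $ 3 / \<delta>] = \<omega>"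
        unfolding fun_cong[OF Teq] using \<delta> by (simp add: vec_eq_iff forall_3)
      have "x * sqrt (t + x\<^sup>2) / M (x * sqrt (t + x\<^sup>2)) = x" for x
      proof -
        have pos: "0 < t + x\<^sup>2" using t by (simp add: add_pos_nonneg)
        have "S (x * sqrt (t + x\<^sup>2)) = t + 2 * x\<^sup>2"
          unfolding S_def
          by (rule real_sqrt_unique) (use pos t in \<open>simp_all add: algebra_simps power2_eq_square\<close>)
        then have "M (x * sqrt (t + x\<^sup>2)) = sqrt (t + x\<^sup>2)" by (simp add: M_def field_simps)
        then show ?thesis using pos by simp
      qed
      then show "\<forall>x\<in>UNIV. \<delta> *\<^sub>R p \<delta> (vector [x $ 1 * sqrt (t + (x $ 1)\<^sup>2) / \<delta>, x $ 2 / \<delta>, x $ 3 / \<delta>]) = x"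
        unfolding fun_cong[OF Teq] using \<delta> by (simp add: vec_eq_iff forall_3)
    qed auto
    show "((\<lambda>\<omega>. \<delta> *\<^sub>R p \<delta> \<omega>) has_derivative (*v) (A \<delta> \<omega>)) (at \<omega>)" for \<omega>
    proof -
      have "((\<lambda>u. \<delta> * u) has_real_derivative \<delta>) (at (\<omega> $ 1))"
        by (auto intro!: derivative_eq_intros)
      from DERIV_chain2[OF Dxi this]
      have "((\<lambda>u. \<delta> * u / M (\<delta> * u)) has_real_derivative \<delta> * D \<delta> \<omega>) (at (\<omega> $ 1))"
        by (simp add: D_def mult.commute)
      then show ?thesis unfolding Teq A_def by (rule has_derivative_diagonal3)
    qed
    show "\<bar>det (A \<delta> \<omega>)\<bar> = \<delta> ^ 3 * D \<delta> \<omega>" for \<omega>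
      using \<delta> M[of "\<delta> * \<omega> $ 1"] S[of "\<delta> * \<omega> $ 1"]
      by (simp add: A_def det_3 abs_mult eval_nat_numeral D_def)
    have c: "continuous_on W (\<lambda>\<omega>. h (\<delta> * \<omega> $ 1))" if "\<And>X. isCont h X" for h :: "real \<Rightarrow> real"
      by (rule continuous_on_compose2[of UNIV h])
         (use that in \<open>auto intro!: continuous_at_imp_continuous_on continuous_intros\<close>)
    have "continuous_on W (D \<delta>)"
      unfolding D_def
      by (intro continuous_on_divide c DERIV_isCont[OF DM] DERIV_isCont[OF DS] ballI less_imp_neq[OF S, symmetric])
    then show "continuous_on {\<omega>. 0 < g \<omega> \<and> g \<omega> < 1} (D \<delta>)" by (simp add: W_def)
  next
    fix n i
    have "uniform_expansion n W (\<lambda>\<delta> \<omega>. \<omega> $ 1 * (1 / M (\<delta> * \<omega> $ 1)))"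
      unfolding Minv by (intro uniform_expansion_mult uniform_expansion_component bdd Mpow)
    then show "uniform_expansion n {\<omega>. 0 < g \<omega> \<and> g \<omega> < 1} (\<lambda>\<delta> \<omega>. p \<delta> \<omega> $ i)"
      unfolding W_def[symmetric] using exhaust_3[of i]
      by (auto simp: p_def intro!: uniform_expansion_component bdd)
  next
    fix n
    have "uniform_expansion n W (\<lambda>\<delta> \<omega>. M (\<delta> * \<omega> $ 1) * (1 / S (\<delta> * \<omega> $ 1)))"
      unfolding Meq Sinv by (intro uniform_expansion_mult Mpow argpow)
    moreover have "D = (\<lambda>\<delta> \<omega>. M (\<delta> * \<omega> $ 1) * (1 / S (\<delta> * \<omega> $ 1)))"
      by (simp add: D_def fun_eq_iff)
    ultimately show "uniform_expansion n {\<omega>. 0 < g \<omega> \<and> g \<omega> < 1} D"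
      by (simp add: W_def)
  next
    show "\<forall>\<^sub>F \<delta> in at_right 0. \<forall>\<omega>\<in>{\<omega>. 0 < g \<omega> \<and> g \<omega> < 1}. sqrt t / sqrt (t\<^sup>2 + 4) \<le> D \<delta> \<omega>"
      unfolding W_def[symmetric] using eventually_at_right_0_bounds
    proof eventually_elim
      case (elim \<delta>)
      show ?case
      proof
        fix \<omega> assume w: "\<omega> \<in> W"
        have "\<bar>\<delta> * \<omega> $ 1\<bar> \<le> 1" unfolding abs_mult using elim W1[OF w] by (intro mult_le_one) auto
        then have "(\<delta> * \<omega> $ 1)\<^sup>2 \<le> 1" by (simp add: abs_square_le_1)
        then have "S (\<delta> * \<omega> $ 1) \<le> sqrt (t\<^sup>2 + 4)" by (simp add: S_def)
        moreover have "sqrt t \<le> M (\<delta> * \<omega> $ 1)" using St by (simp add: M_def)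
        ultimately show "sqrt t / sqrt (t\<^sup>2 + 4) \<le> D \<delta> \<omega>"
          unfolding D_def using S M t by (intro frac_le) (auto intro: less_imp_le)
      qed
    qed
  qed (auto intro: admissible_phase_U)
  then show ?thesis by simp
qed

section \<open>Even functions of a square root\<close>

text \<open>If \<open>N j\<close> is the \<open>j\<close>-th derivative of an even function, \<open>even_quotient N\<close> is the derivative
  sequence of \<open>r \<mapsto> N 1 r / (2 * r)\<close>, written as an integral to be smooth at 0; it is the derivative
  of \<open>N 0\<close> with respect to \<open>r\<^sup>2\<close>.\<close>

definition even_quotient :: "(nat \<Rightarrow> real \<Rightarrow> real) \<Rightarrow> nat \<Rightarrow> real \<Rightarrow> real" where
  "even_quotient N j r = integral {0..1} (\<lambda>s. s ^ j * N (j + 2) (s * r)) / 2"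

context
  fixes N :: "nat \<Rightarrow> real \<Rightarrow> real"
  assumes deriv: "\<And>j r. (N j has_real_derivative N (Suc j) r) (at r)"
    and even: "\<And>r. N 0 (- r) = N 0 r"
begin

lemma derivatives_continuous: "continuous_on S (N j)"
  by (intro continuous_at_imp_continuous_on ballI DERIV_isCont[OF deriv])

text \<open>Needed at two places: \<open>N 1\<close> vanishes at 0, and \<open>N 2\<close> is
  even.\<close>

lemma derivatives_parity: "N j (- r) = (- 1) ^ j * N j r"
proof (induction j arbitrary: r)
  case (Suc j)
  have "((\<lambda>r. N j (- r)) has_real_derivative N (Suc j) (- r) * - 1) (at r)"
    by (rule DERIV_chain2[OF deriv]) (auto intro!: derivative_eq_intros)
  moreover have "((\<lambda>r. (- 1) ^ j * N j r) has_real_derivative (- 1) ^ j * N (Suc j) r) (at r)"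
    by (rule DERIV_cmult[OF deriv])
  ultimately have "N (Suc j) (- r) * - 1 = (- 1) ^ j * N (Suc j) r"
    unfolding Suc by (rule DERIV_unique)
  then show ?case by simp
qed (simp add: even)

lemma continuous_on_even_quotient_integrand:
  "continuous_on S (\<lambda>(r, s). s ^ j * N (j + k) (s * r))"
  unfolding case_prod_beta
  by (intro continuous_intros continuous_on_compose2[OF derivatives_continuous[of UNIV]]) auto

lemma even_quotient_integrable: "(\<lambda>s. s ^ j * N (j + k) (s * r)) integrable_on {0..1}"
  by (intro integrable_continuous_real continuous_intros
        continuous_on_compose2[OF derivatives_continuous[of UNIV]]) auto

text \<open>Differentiation under the integral sign. Each derivative in \<open>r\<close> brings out
  a factor \<open>s\<close>, which explains the weight \<open>s ^ j\<close>.\<close>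

lemma even_quotient_deriv:
  "(even_quotient N j has_real_derivative even_quotient N (Suc j) r) (at r)"
proof -
  have "((\<lambda>r. integral (cbox 0 1) (\<lambda>s. s ^ j * N (j + 2) (s * r))) has_real_derivative
      integral (cbox 0 1) (\<lambda>s. s ^ Suc j * N (Suc j + 2) (s * r))) (at r within UNIV)"
  proof (rule leibniz_rule_field_derivative)
    fix r s :: real
    have "((\<lambda>r. s * r) has_real_derivative s) (at r)"
      by (auto intro!: derivative_eq_intros)
    from DERIV_cmult[OF DERIV_chain2[OF deriv this], of "s ^ j" "j + 2"]
    show "((\<lambda>r. s ^ j * N (j + 2) (s * r)) has_real_derivative s ^ Suc j * N (Suc j + 2) (s * r)) (at r within UNIV)"
      by (simp add: ac_simps)
  qed (use even_quotient_integrable[of j 2] continuous_on_even_quotient_integrand[of _ "Suc j" 2] in auto)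
  then show ?thesis
    unfolding even_quotient_def[abs_def] by (auto intro: DERIV_cdivide)
qed

lemma even_quotient_even: "even_quotient N 0 (- r) = even_quotient N 0 r"
  using derivatives_parity[of 2] by (simp add: even_quotient_def numeral_2_eq_2)

text \<open>The weight is at most 1 and \<open>s * r\<close> stays within the bound on
  \<open>r\<close>. Nothing is divided by \<open>r\<close>, so the estimate holds down to
  \<open>r = 0\<close>.\<close>

lemma even_quotient_bound:
  assumes "\<And>r. \<bar>r\<bar> \<le> R \<Longrightarrow> \<bar>N (j + 2) r\<bar> \<le> m" "\<bar>r\<bar> \<le> R"
  shows "\<bar>even_quotient N j r\<bar> \<le> m"
proof -
  have "norm (integral {0..1} (\<lambda>s. s ^ j * N (j + 2) (s * r))) \<le> m * (1 - 0)"
  proof (rule integral_bound)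
    show "continuous_on {0..1} (\<lambda>s. s ^ j * N (j + 2) (s * r))"
      by (intro continuous_intros continuous_on_compose2[OF derivatives_continuous[of UNIV]]) auto
    fix s :: real assume s: "s \<in> {0..1}"
    have "\<bar>s * r\<bar> \<le> 1 * \<bar>r\<bar>" unfolding abs_mult using s by (intro mult_right_mono) auto
    then have "\<bar>N (j + 2) (s * r)\<bar> \<le> m" using assms by simp
    moreover have "\<bar>s ^ j\<bar> \<le> 1" using s by (simp add: power_le_one)
    ultimately have "\<bar>s ^ j\<bar> * \<bar>N (j + 2) (s * r)\<bar> \<le> 1 * m" by (intro mult_mono) auto
    then show "norm (s ^ j * N (j + 2) (s * r)) \<le> m" by (simp add: abs_mult)
  qed simp
  then show ?thesis by (simp add: even_quotient_def)
qed

text \<open>The chain rule gives N 1 r / (2 r) at r = sqrt a. Since \<open>N 1 0 = 0\<close>, the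
  fundamental theorem of calculus writes N 1 r as r times the integral of \<open>N 2 (s * r)\<close>
  over the unit interval, and r cancels.\<close>

lemma even_sqrt_deriv:
  assumes "0 < a"
  shows "((\<lambda>a. N 0 (sqrt a)) has_real_derivative even_quotient N 0 (sqrt a)) (at a)"
proof -
  have "((\<lambda>s. sqrt a * N 2 (s * sqrt a)) has_integral N 1 (1 * sqrt a) - N 1 (0 * sqrt a)) {0..1}"
  proof (rule fundamental_theorem_of_calculus)
    fix s :: real
    have "((\<lambda>s. s * sqrt a) has_real_derivative sqrt a) (at s)"
      by (auto intro!: derivative_eq_intros)
    from DERIV_chain2[OF deriv this, of 1]
    show "((\<lambda>s. N 1 (s * sqrt a)) has_vector_derivative sqrt a * N 2 (s * sqrt a)) (at s within {0..1})"
      by (auto simp: has_real_derivative_iff_has_vector_derivative numeral_2_eq_2 mult.commute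
            intro: has_vector_derivative_at_within)
  qed simp
  moreover have "N 1 0 = 0" using derivatives_parity[of 1 0] by simp
  ultimately have N1: "N 1 (sqrt a) = sqrt a * integral {0..1} (\<lambda>s. N 2 (s * sqrt a))"
    by (simp add: has_integral_iff)
  have "((\<lambda>a. N 0 (sqrt a)) has_real_derivative N 1 (sqrt a) * (inverse (sqrt a) / 2)) (at a)"
    using DERIV_chain2[OF deriv DERIV_real_sqrt[OF assms], of 0] by simp
  also have "N 1 (sqrt a) * (inverse (sqrt a) / 2) = even_quotient N 0 (sqrt a)"
    unfolding N1 even_quotient_def using assms by (simp add: numeral_2_eq_2)
  finally show ?thesis .
qed

end

text \<open>Each quotient consumes two derivatives of the original function, hence the index
  \<open>j + 2 * k\<close> of the bound; evenness is reproduced, which keeps the iteration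
  going.\<close>

lemma even_quotient_iterate:
  assumes "\<And>j r. (N j has_real_derivative N (Suc j) r) (at r)" "\<And>r. N 0 (- r) = N 0 r"
    and "\<And>j r. \<bar>r\<bar> \<le> R \<Longrightarrow> \<bar>N j r\<bar> \<le> m j"
  shows "((even_quotient ^^ k) N j has_real_derivative (even_quotient ^^ k) N (Suc j) r) (at r) \<and>
    (even_quotient ^^ k) N 0 (- r) = (even_quotient ^^ k) N 0 r \<and>
    (\<bar>r\<bar> \<le> R \<longrightarrow> \<bar>(even_quotient ^^ k) N j r\<bar> \<le> m (j + 2 * k))"
proof (induction k arbitrary: j r)
  case (Suc k)
  let ?N = "(even_quotient ^^ k) N"
  have 1: "\<And>j r. (?N j has_real_derivative ?N (Suc j) r) (at r)" "\<And>r. ?N 0 (- r) = ?N 0 r"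
    and 2: "\<And>j r. \<bar>r\<bar> \<le> R \<Longrightarrow> \<bar>?N j r\<bar> \<le> m (j + 2 * k)"
    using Suc by auto
  have "\<bar>r\<bar> \<le> R \<Longrightarrow> \<bar>even_quotient ?N j r\<bar> \<le> m (j + 2 * Suc k)"
    by (rule even_quotient_bound[OF 1]) (use 2[of _ "j + 2"] in auto)
  with even_quotient_deriv[OF 1] even_quotient_even[OF 1] show ?case by simp
qed (use assms in simp)

text \<open>Taylor's formula in the squared radius. The constant does not depend on the base point
  \<open>a\<close>, which is what makes the later expansion uniform where h(x) is small.\<close>

lemma even_sqrt_taylor:
  assumes N: "\<And>j r. (N j has_real_derivative N (Suc j) r) (at r)" "\<And>r. N 0 (- r) = N 0 r"
    "\<And>j r. \<bar>r\<bar> \<le> R \<Longrightarrow> \<bar>N j r\<bar> \<le> m j"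
    and a: "0 \<le> a" "0 < \<eta>" "sqrt (a + \<eta>) < R"
  shows "\<bar>N 0 (sqrt (a + \<eta>)) - (\<Sum>k<n. (even_quotient ^^ k) N 0 (sqrt a) / fact k * \<eta> ^ k)\<bar>
    \<le> m (2 * n) * \<eta> ^ n"
proof -
  define P where "P k a = (even_quotient ^^ k) N 0 (sqrt a)" for k a
  note it = even_quotient_iterate[OF N, where R = R]
  have P_deriv: "(P k has_real_derivative P (Suc k) a) (at a)" if "0 < a" for k a
    unfolding P_def using even_sqrt_deriv[of "(even_quotient ^^ k) N" a] it that by auto
  define \<Phi> where "\<Phi> a = P 0 (a + \<eta>) - (\<Sum>k<n. P k a / fact k * \<eta> ^ k)" for a
  have *: "\<bar>\<Phi> a\<bar> \<le> m (2 * n) * \<eta> ^ n" if a0: "0 < a" "sqrt (a + \<eta>) < R" for a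
  proof -
    have "\<exists>s>0. s \<le> \<eta> \<and> P 0 (a + \<eta>) = (\<Sum>k<n. P k (a + 0) / fact k * \<eta> ^ k) + P n (a + s) / fact n * \<eta> ^ n"
    proof (rule Maclaurin2[where f = "\<lambda>s. P 0 (a + s)" and diff = "\<lambda>k s. P k (a + s)", OF a(2) refl], intro allI impI)
      fix k s assume "k < n \<and> 0 \<le> s \<and> s \<le> \<eta>"
      then have "(P k has_real_derivative P (Suc k) (a + s)) (at (a + s))"
        using a0 by (intro P_deriv) auto
      moreover have "((\<lambda>s. a + s) has_real_derivative 1) (at s)"
        by (auto intro!: derivative_eq_intros)
      ultimately show "((\<lambda>s. P k (a + s)) has_real_derivative P (Suc k) (a + s)) (at s)"
        using DERIV_chain2[where f = "P k" and g = "\<lambda>s. a + s" and x = s and s = UNIV and Db = 1] by simp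
    qed
    then obtain s where s: "0 < s" "s \<le> \<eta>" and eq: "\<Phi> a = P n (a + s) / fact n * \<eta> ^ n"
      by (auto simp: \<Phi>_def)
    have "sqrt (a + s) \<le> sqrt (a + \<eta>)" using s by simp
    moreover have "0 \<le> sqrt (a + s)" using a0 s by simp
    ultimately have "\<bar>sqrt (a + s)\<bar> \<le> R" using a0 by linarith
    then have "\<bar>P n (a + s)\<bar> \<le> m (2 * n)" using it[where j = 0] by (simp add: P_def)
    moreover have "\<bar>P n (a + s)\<bar> / fact n \<le> \<bar>P n (a + s)\<bar>"
      using mult_right_mono[OF fact_ge_1[of n, where 'a = real], of "\<bar>P n (a + s)\<bar>"]
      by (simp add: field_simps)
    ultimately have "\<bar>P n (a + s) / fact n\<bar> \<le> m (2 * n)" by simp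
    from mult_right_mono[OF this, of "\<eta> ^ n"] show ?thesis
      using a(2) by (simp add: eq abs_mult)
  qed
  have "\<bar>\<Phi> a\<bar> \<le> m (2 * n) * \<eta> ^ n"
  proof (cases "a = 0")
    \<comment> \<open>At \<open>a = 0\<close> the square root is not differentiable, so the estimate
      is a limit from \<open>a > 0\<close>. The remainder \<Phi> is continuous in \<open>a\<close>,
      and the strict bound \<open>sqrt (a + \<eta>) < R\<close> persists nearby.\<close>
    case True
    have Pc: "isCont (P k) x" for k x
      unfolding P_def
      by (rule isCont_o2[OF isCont_real_sqrt]) (use it DERIV_isCont in blast)
    have "isCont \<Phi> 0" unfolding \<Phi>_def
      by (intro continuous_intros isCont_o2[OF _ Pc] Pc) auto
    then have lim: "(\<Phi> \<longlongrightarrow> \<Phi> 0) (at_right 0)"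
      using isContD filterlim_at_split by blast
    have "((\<lambda>a. sqrt (a + \<eta>)) \<longlongrightarrow> sqrt (0 + \<eta>)) (at_right 0)"
      by (intro tendsto_intros)
    then have "\<forall>\<^sub>F a in at_right 0. sqrt (a + \<eta>) < R"
      by (rule order_tendstoD) (use a True in simp)
    with eventually_at_right_0_bounds have "\<forall>\<^sub>F a in at_right 0. \<bar>\<Phi> a\<bar> \<le> m (2 * n) * \<eta> ^ n"
      by eventually_elim (use * in blast)
    then show ?thesis
      unfolding True by (rule tendsto_upperbound[OF tendsto_rabs[OF lim]]) simp
  qed (use * a in auto)
  then show ?thesis by (simp add: \<Phi>_def P_def)
qed

section \<open>Polar coordinates around the first axis\<close>

text \<open>The argument \<open>\<sigma> = \<plusminus>1\<close> selects the half space \<open>z > 0\<close> or \<open>z < 0\<close>; the angle stays in \<open>(0, \<pi>)\<close>.\<close>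

definition polar :: "(real \<Rightarrow> real) \<Rightarrow> real \<Rightarrow> real \<Rightarrow> real ^ 3 \<Rightarrow> real ^ 3" where
  "polar h \<sigma> \<delta> \<omega> = vector [\<omega> $ 1,
     \<sigma> * (sqrt (h (\<omega> $ 1) + \<delta> * \<omega> $ 3) * cos (\<omega> $ 2)),
     \<sigma> * (sqrt (h (\<omega> $ 1) + \<delta> * \<omega> $ 3) * sin (\<omega> $ 2))]"

definition polar_box :: "real \<Rightarrow> (real ^ 3) set" where
  "polar_box \<rho> = {\<omega>. \<bar>\<omega> $ 1\<bar> < \<rho> \<and> 0 < \<omega> $ 2 \<and> \<omega> $ 2 < pi \<and> 0 < \<omega> $ 3 \<and> \<omega> $ 3 < 1}"

lemma polar_nth [simp]:
  "polar h \<sigma> \<delta> \<omega> $ 1 = \<omega> $ 1"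
  "polar h \<sigma> \<delta> \<omega> $ 2 = \<sigma> * (sqrt (h (\<omega> $ 1) + \<delta> * \<omega> $ 3) * cos (\<omega> $ 2))"
  "polar h \<sigma> \<delta> \<omega> $ 3 = \<sigma> * (sqrt (h (\<omega> $ 1) + \<delta> * \<omega> $ 3) * sin (\<omega> $ 2))"
  by (simp_all add: polar_def)

lemma open_polar_box: "open (polar_box \<rho>)"
  unfolding polar_box_def Collect_conj_eq
  by (intro open_Int open_Collect_less continuous_intros)

lemma bounded_polar_box: "bounded (polar_box \<rho>)"
  by (rule bounded_vec3I[where a = \<rho> and b = pi and c = 1]) (auto simp: polar_box_def)

lemma polar_radius:
  assumes "\<sigma>\<^sup>2 = 1" "0 \<le> h (\<omega> $ 1) + \<delta> * \<omega> $ 3"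
  shows "(polar h \<sigma> \<delta> \<omega> $ 2)\<^sup>2 + (polar h \<sigma> \<delta> \<omega> $ 3)\<^sup>2 = h (\<omega> $ 1) + \<delta> * \<omega> $ 3"
proof -
  let ?r = "sqrt (h (\<omega> $ 1) + \<delta> * \<omega> $ 3)"
  have "(polar h \<sigma> \<delta> \<omega> $ 2)\<^sup>2 + (polar h \<sigma> \<delta> \<omega> $ 3)\<^sup>2 =
      \<sigma>\<^sup>2 * ?r\<^sup>2 * ((cos (\<omega> $ 2))\<^sup>2 + (sin (\<omega> $ 2))\<^sup>2)"
    unfolding polar_nth by algebra
  also have "\<dots> = h (\<omega> $ 1) + \<delta> * \<omega> $ 3" using assms by simp
  finally show ?thesis .
qed

lemma polar_has_derivative:
  fixes \<omega> :: "real ^ 3"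
  assumes h: "(h has_real_derivative h') (at (\<omega> $ 1))" and pos: "0 < h (\<omega> $ 1) + \<delta> * \<omega> $ 3"
  defines "r \<equiv> sqrt (h (\<omega> $ 1) + \<delta> * \<omega> $ 3)" and "c \<equiv> cos (\<omega> $ 2)" and "s \<equiv> sin (\<omega> $ 2)"
  shows "(polar h \<sigma> \<delta> has_derivative (*v) (vector [vector [1, 0, 0],
      vector [\<sigma> * c * h' / (2 * r), - (\<sigma> * r * s), \<sigma> * c * \<delta> / (2 * r)],
      vector [\<sigma> * s * h' / (2 * r), \<sigma> * r * c, \<sigma> * s * \<delta> / (2 * r)]])) (at \<omega>)"
proof (rule has_derivative_componentwise_vec)
  fix i :: 3
  have r: "0 < r" using pos by (simp add: r_def)
  have nth: "((\<lambda>\<omega>. \<omega> $ j) has_derivative (\<lambda>v. v $ j)) (at \<omega>)" for j :: 3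
    by (rule bounded_linear_imp_has_derivative[OF bounded_linear_vec_nth])
  have dh: "((\<lambda>\<omega>. h (\<omega> $ 1)) has_derivative (\<lambda>v. h' * v $ 1)) (at \<omega>)"
    using has_derivative_compose[OF nth h[unfolded has_field_derivative_def]] .
  have "((\<lambda>\<omega>. h (\<omega> $ 1) + \<delta> * \<omega> $ 3) has_derivative (\<lambda>v. h' * v $ 1 + \<delta> * v $ 3)) (at \<omega>)"
    by (intro has_derivative_add dh has_derivative_mult_right nth)
  from has_derivative_compose[OF this DERIV_real_sqrt[OF pos, unfolded has_field_derivative_def]]
  have dr: "((\<lambda>\<omega>. sqrt (h (\<omega> $ 1) + \<delta> * \<omega> $ 3)) has_derivative
      (\<lambda>v. inverse r / 2 * (h' * v $ 1 + \<delta> * v $ 3))) (at \<omega>)"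
    by (simp add: r_def)
  have dc: "((\<lambda>\<omega>. cos (\<omega> $ 2)) has_derivative (\<lambda>v. - s * v $ 2)) (at \<omega>)"
    unfolding s_def by (rule has_derivative_compose[OF nth DERIV_cos[unfolded has_field_derivative_def]])
  have ds: "((\<lambda>\<omega>. sin (\<omega> $ 2)) has_derivative (\<lambda>v. c * v $ 2)) (at \<omega>)"
    unfolding c_def by (rule has_derivative_compose[OF nth DERIV_sin[unfolded has_field_derivative_def]])
  let ?A = "vector [vector [1, 0, 0],
      vector [\<sigma> * c * h' / (2 * r), - (\<sigma> * r * s), \<sigma> * c * \<delta> / (2 * r)],
      vector [\<sigma> * s * h' / (2 * r), \<sigma> * r * c, \<sigma> * s * \<delta> / (2 * r)]] :: real ^ 3 ^ 3"
  have 2: "((\<lambda>\<omega>. polar h \<sigma> \<delta> \<omega> $ 2) has_derivative (\<lambda>v. (?A *v v) $ 2)) (at \<omega>)"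
    unfolding polar_nth
    by (rule has_derivative_eq_rhs[OF has_derivative_mult_right[OF has_derivative_mult[OF dr dc]]])
       (use r in \<open>auto simp: fun_eq_iff matrix_vector_mult_def sum_3 field_simps simp flip: r_def c_def s_def\<close>)
  have 3: "((\<lambda>\<omega>. polar h \<sigma> \<delta> \<omega> $ 3) has_derivative (\<lambda>v. (?A *v v) $ 3)) (at \<omega>)"
    unfolding polar_nth
    by (rule has_derivative_eq_rhs[OF has_derivative_mult_right[OF has_derivative_mult[OF dr ds]]])
       (use r in \<open>auto simp: fun_eq_iff matrix_vector_mult_def sum_3 field_simps simp flip: r_def c_def s_def\<close>)
  have 1: "((\<lambda>\<omega>. polar h \<sigma> \<delta> \<omega> $ 1) has_derivative (\<lambda>v. (?A *v v) $ 1)) (at \<omega>)"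
    using nth[of 1] by (simp add: matrix_vector_mult_def sum_3)
  show "((\<lambda>\<omega>. polar h \<sigma> \<delta> \<omega> $ i) has_derivative (\<lambda>v. (?A *v v) $ i)) (at \<omega>)"
    using exhaust_3[of i] 1 2 3 by metis
qed

text \<open>The inverse takes the angle from \<open>arccos\<close> and the third coordinate from the
  value of the function divided by \<delta>. Strict positivity of \<open>\<sigma> * x $ 3\<close>
  keeps the argument of \<open>arccos\<close> strictly between -1 and 1, hence the angle strictly
  between 0 and pi.\<close>

lemma polar_image:
  assumes \<sigma>: "\<sigma> = 1 \<or> \<sigma> = -1" and \<delta>: "0 < \<delta>" and h: "\<And>x. \<bar>x\<bar> < \<rho> \<Longrightarrow> 0 \<le> h x"
  shows "polar h \<sigma> \<delta> ` polar_box \<rho> = {x. \<bar>x $ 1\<bar> < \<rho> \<and> 0 < \<sigma> * x $ 3 \<and>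
      0 < (x $ 2)\<^sup>2 + (x $ 3)\<^sup>2 - h (x $ 1) \<and> (x $ 2)\<^sup>2 + (x $ 3)\<^sup>2 - h (x $ 1) < \<delta>}" (is "_ = ?R")
    and "inj_on (polar h \<sigma> \<delta>) (polar_box \<rho>)"
proof -
  have \<sigma>2: "\<sigma>\<^sup>2 = 1" using \<sigma> by auto
  have pos: "0 < h (\<omega> $ 1) + \<delta> * \<omega> $ 3" if "\<omega> \<in> polar_box \<rho>" for \<omega>
    using h[of "\<omega> $ 1"] \<delta> that by (simp add: polar_box_def add_nonneg_pos)
  have rad: "(polar h \<sigma> \<delta> \<omega> $ 2)\<^sup>2 + (polar h \<sigma> \<delta> \<omega> $ 3)\<^sup>2 = h (\<omega> $ 1) + \<delta> * \<omega> $ 3"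
    if "\<omega> \<in> polar_box \<rho>" for \<omega>
    using polar_radius[OF \<sigma>2] pos[OF that] by (simp add: less_imp_le)
  show "polar h \<sigma> \<delta> ` polar_box \<rho> = ?R"
  proof (intro set_eqI iffI)
    fix x assume "x \<in> polar h \<sigma> \<delta> ` polar_box \<rho>"
    then obtain \<omega> where w: "\<omega> \<in> polar_box \<rho>" and x: "x = polar h \<sigma> \<delta> \<omega>" by (elim imageE)
    have "\<sigma> * x $ 3 = sqrt (h (\<omega> $ 1) + \<delta> * \<omega> $ 3) * sin (\<omega> $ 2)"
      using \<sigma> by (auto simp: x)
    moreover have "0 < sqrt (h (\<omega> $ 1) + \<delta> * \<omega> $ 3) * sin (\<omega> $ 2)"
      using pos[OF w] w by (auto simp: polar_box_def intro!: mult_pos_pos sin_gt_zero)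
    moreover have u: "(x $ 2)\<^sup>2 + (x $ 3)\<^sup>2 - h (x $ 1) = \<delta> * \<omega> $ 3"
      using rad[OF w] by (simp add: x del: polar_nth(2,3))
    moreover have "x $ 1 = \<omega> $ 1" by (simp add: x)
    ultimately show "x \<in> ?R" unfolding mem_Collect_eq u using w \<delta> by (simp add: polar_box_def)
  next
    fix x assume x: "x \<in> ?R"
    define u where "u = (x $ 2)\<^sup>2 + (x $ 3)\<^sup>2 - h (x $ 1)"
    define r where "r = sqrt ((x $ 2)\<^sup>2 + (x $ 3)\<^sup>2)"
    define \<theta> where "\<theta> = arccos (\<sigma> * x $ 2 / r)"
    have z: "0 < \<sigma> * x $ 3" using x by simp
    then have "x $ 3 \<noteq> 0" by auto
    then have r2: "0 < (x $ 2)\<^sup>2 + (x $ 3)\<^sup>2" by (simp add: add_nonneg_pos)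
    then have r: "0 < r" "r\<^sup>2 = (x $ 2)\<^sup>2 + (x $ 3)\<^sup>2" by (auto simp: r_def)
    define q where "q = \<sigma> * x $ 2 / r"
    have "(\<sigma> * x $ 2 / r)\<^sup>2 < 1"
      using r r2 \<open>x $ 3 \<noteq> 0\<close> by (simp add: power_divide power_mult_distrib \<sigma>2)
    then have "\<bar>q\<bar> < 1" by (simp only: abs_square_less_1 q_def)
    then have lt: "- 1 < q" "q < 1" by linarith+
    have \<theta>q: "\<theta> = arccos q" by (simp only: \<theta>_def q_def)
    have c: "cos \<theta> = \<sigma> * x $ 2 / r"
      using cos_arccos[OF less_imp_le[OF lt(1)] less_imp_le[OF lt(2)]] by (simp only: \<theta>q q_def)
    have \<theta>: "0 < \<theta>" "\<theta> < pi" using arccos_lt_bounded[OF lt] by (simp_all only: \<theta>q)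
    \<comment> \<open>The cosine fixes the sine up to sign; both \<open>r * sin \<theta>\<close> and
      \<open>\<sigma> * x $ 3\<close> are nonnegative, which settles the sign.\<close>
    have "(r * sin \<theta>)\<^sup>2 = r\<^sup>2 - (r * cos \<theta>)\<^sup>2"
      by (simp add: power_mult_distrib sin_squared_eq right_diff_distrib)
    also have "\<dots> = (\<sigma> * x $ 3)\<^sup>2" unfolding c using r by (simp add: power_mult_distrib \<sigma>2)
    finally have sq: "(r * sin \<theta>)\<^sup>2 = (\<sigma> * x $ 3)\<^sup>2" .
    have "0 \<le> r * sin \<theta>" using r(1) \<theta> by (intro mult_nonneg_nonneg sin_ge_zero less_imp_le)
    then have s: "r * sin \<theta> = \<sigma> * x $ 3"
      by (rule power2_eq_imp_eq[OF sq _ less_imp_le[OF z]])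
    define \<omega> where "\<omega> = (vector [x $ 1, \<theta>, u / \<delta>] :: real ^ 3)"
    have rr: "sqrt (h (\<omega> $ 1) + \<delta> * \<omega> $ 3) = r" using \<delta> by (simp add: \<omega>_def u_def r_def)
    have w: "\<omega> $ 1 = x $ 1" "\<omega> $ 2 = \<theta>" by (simp_all add: \<omega>_def)
    have "\<sigma> * (r * cos \<theta>) = \<sigma>\<^sup>2 * x $ 2" "\<sigma> * (r * sin \<theta>) = \<sigma>\<^sup>2 * x $ 3"
      unfolding c s using r(1) by (simp_all add: power2_eq_square)
    then have "polar h \<sigma> \<delta> \<omega> $ 2 = x $ 2" "polar h \<sigma> \<delta> \<omega> $ 3 = x $ 3"
      unfolding polar_nth rr w(2) by (simp_all only: \<sigma>2 mult_1)
    with w(1) have xw: "x = polar h \<sigma> \<delta> \<omega>"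
      unfolding vec_eq_iff forall_3 by (intro conjI) (simp_all only: polar_nth(1))
    have "\<omega> \<in> polar_box \<rho>"
      using x \<theta> \<delta> by (simp add: polar_box_def \<omega>_def u_def)
    then show "x \<in> polar h \<sigma> \<delta> ` polar_box \<rho>" unfolding xw by (rule imageI)
  qed
  show "inj_on (polar h \<sigma> \<delta>) (polar_box \<rho>)"
  proof (rule inj_onI)
    fix \<omega> \<omega>' assume w: "\<omega> \<in> polar_box \<rho>" "\<omega>' \<in> polar_box \<rho>" and eq: "polar h \<sigma> \<delta> \<omega> = polar h \<sigma> \<delta> \<omega>'"
    from eq have eqi: "polar h \<sigma> \<delta> \<omega> $ i = polar h \<sigma> \<delta> \<omega>' $ i" for i by simp
    from eqi[of 1] have 1: "\<omega> $ 1 = \<omega>' $ 1" unfolding polar_nth .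
    from rad[OF w(1)] have "(polar h \<sigma> \<delta> \<omega>' $ 2)\<^sup>2 + (polar h \<sigma> \<delta> \<omega>' $ 3)\<^sup>2 = h (\<omega>' $ 1) + \<delta> * \<omega> $ 3"
      unfolding eqi 1 .
    then have "h (\<omega>' $ 1) + \<delta> * \<omega> $ 3 = h (\<omega>' $ 1) + \<delta> * \<omega>' $ 3"
      unfolding rad[OF w(2)] by (rule sym)
    then have 3: "\<omega> $ 3 = \<omega>' $ 3" using \<delta> by simp
    define R where "R = \<sigma> * sqrt (h (\<omega>' $ 1) + \<delta> * \<omega>' $ 3)"
    have "R \<noteq> 0" using \<sigma> pos[OF w(2)] unfolding R_def by auto
    moreover have "R * cos (\<omega> $ 2) = R * cos (\<omega>' $ 2)"
      using eqi[of 2] unfolding polar_nth 1 3 R_def mult.assoc .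
    ultimately have "cos (\<omega> $ 2) = cos (\<omega>' $ 2)" by simp
    then have "\<omega> $ 2 = \<omega>' $ 2"
      by (rule cos_inj_pi[rotated 4]) (use w in \<open>auto simp: polar_box_def\<close>)
    with 1 3 show "\<omega> = \<omega>'" by (simp add: vec_eq_iff forall_3)
  qed
qed


lemma continuous_on_polar:
  assumes "continuous_on UNIV h"
  shows "continuous_on S (polar h \<sigma> \<delta>)"
proof -
  have h: "continuous_on S (\<lambda>\<omega>. h (\<omega> $ 1))"
    by (rule continuous_on_compose2[OF assms]) (auto intro: continuous_intros)
  have "continuous_on S (\<lambda>\<omega>. polar h \<sigma> \<delta> \<omega> $ 1)" "continuous_on S (\<lambda>\<omega>. polar h \<sigma> \<delta> \<omega> $ 2)"
    "continuous_on S (\<lambda>\<omega>. polar h \<sigma> \<delta> \<omega> $ 3)"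
    unfolding polar_nth by (intro continuous_intros h)+
  then have "continuous_on S (\<lambda>\<omega>. polar h \<sigma> \<delta> \<omega> $ i)" for i
    using exhaust_3[of i] by metis
  then have "continuous_on S (\<lambda>\<omega>. \<chi> i. polar h \<sigma> \<delta> \<omega> $ i)"
    by (rule continuous_on_vec_lambda)
  then show ?thesis by simp
qed

text \<open>With r^2 = h + \<delta>s at fixed x, the area element r dr d\<theta> becomes \<delta>/2
  ds d\<theta>: the radius cancels and the Jacobian is constant.\<close>

lemma set_integral_polar:
  assumes \<sigma>: "\<sigma> = 1 \<or> \<sigma> = -1" and \<delta>: "0 < \<delta>" and h: "\<And>x. \<bar>x\<bar> < \<rho> \<Longrightarrow> 0 \<le> h x"
    and dh: "\<And>x. (h has_real_derivative h' x) (at x)"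
    and phi: "continuous_on UNIV \<phi>" "set_integrable lborel (polar h \<sigma> \<delta> ` polar_box \<rho>) \<phi>"
  shows "(LINT x:polar h \<sigma> \<delta> ` polar_box \<rho>|lborel. \<phi> x) =
     \<delta> / 2 * (LINT \<omega>:polar_box \<rho>|lborel. \<phi> (polar h \<sigma> \<delta> \<omega>))"
proof -
  define A where "A \<omega> = (let r = sqrt (h (\<omega> $ 1) + \<delta> * \<omega> $ 3); c = cos (\<omega> $ 2); s = sin (\<omega> $ 2) in
     vector [vector [1, 0, 0],
      vector [\<sigma> * c * h' (\<omega> $ 1) / (2 * r), - (\<sigma> * r * s), \<sigma> * c * \<delta> / (2 * r)],
      vector [\<sigma> * s * h' (\<omega> $ 1) / (2 * r), \<sigma> * r * c, \<sigma> * s * \<delta> / (2 * r)]] :: real ^ 3 ^ 3)" for \<omega> :: "real ^ 3"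
  have pos: "0 < h (\<omega> $ 1) + \<delta> * \<omega> $ 3" if "\<omega> \<in> polar_box \<rho>" for \<omega>
    using h[of "\<omega> $ 1"] \<delta> that by (simp add: polar_box_def add_nonneg_pos)
  have det: "\<bar>det (A \<omega>)\<bar> = \<delta> / 2" if "\<omega> \<in> polar_box \<rho>" for \<omega>
  proof -
    let ?r = "sqrt (h (\<omega> $ 1) + \<delta> * \<omega> $ 3)" and ?c = "cos (\<omega> $ 2)" and ?s = "sin (\<omega> $ 2)"
    have r: "0 < ?r" using pos[OF that] by simp
    \<comment> \<open>The entries \<open>a\<close> and \<open>b\<close> involve \<open>h'\<close>,
      but the first row (1, 0, 0) removes them from the determinant.\<close>
    have "det (vector [vector [1, 0, 0], vector [a, - (\<sigma> * r * s), \<sigma> * c * \<delta> / (2 * r)],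
        vector [b, \<sigma> * r * c, \<sigma> * s * \<delta> / (2 * r)]] :: real ^ 3 ^ 3) = - (\<sigma>\<^sup>2 * \<delta> / 2 * (s\<^sup>2 + c\<^sup>2))"
      if "0 < r" for a b c r s :: real
      using that by (simp add: det_3 field_simps power2_eq_square)
    from this[OF r] have "det (A \<omega>) = - (\<sigma>\<^sup>2 * \<delta> / 2 * (?s\<^sup>2 + ?c\<^sup>2))"
      unfolding A_def Let_def .
    then show ?thesis using \<sigma> \<delta> by auto
  qed
  have cont: "continuous_on (polar_box \<rho>) (\<lambda>\<omega>. \<phi> (polar h \<sigma> \<delta> \<omega>))"
    by (rule continuous_on_compose2[OF phi(1) continuous_on_polar])
       (use dh in \<open>auto intro: continuous_at_imp_continuous_on DERIV_isCont\<close>)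
  have "(LINT x:polar h \<sigma> \<delta> ` polar_box \<rho>|lborel. \<phi> x) =
      (LINT \<omega>:polar_box \<rho>|lborel. \<bar>det (A \<omega>)\<bar> * \<phi> (polar h \<sigma> \<delta> \<omega>))"
  proof (rule set_integral_change_of_variables[OF _ _ polar_image(2)[OF \<sigma> \<delta> h] phi(2)])
    show "(polar h \<sigma> \<delta> has_derivative (*v) (A \<omega>)) (at \<omega>)" if "\<omega> \<in> polar_box \<rho>" for \<omega>
      unfolding A_def Let_def by (rule polar_has_derivative[OF dh pos[OF that]])
    have "continuous_on (polar_box \<rho>) (\<lambda>\<omega>. \<delta> / 2 * \<phi> (polar h \<sigma> \<delta> \<omega>))"
      by (intro continuous_intros cont)
    then show "continuous_on (polar_box \<rho>) (\<lambda>\<omega>. \<bar>det (A \<omega>)\<bar> * \<phi> (polar h \<sigma> \<delta> \<omega>))"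
      by (simp add: det cong: continuous_on_cong)
  qed (simp_all add: open_polar_box borel_open)
  also have "\<dots> = (LINT \<omega>:polar_box \<rho>|lborel. \<delta> / 2 * \<phi> (polar h \<sigma> \<delta> \<omega>))"
    by (rule set_lebesgue_integral_cong) (auto simp: det open_polar_box borel_open)
  finally show ?thesis by simp
qed

text \<open>For fixed \<omega> the two points are (x, 0, 0) plus and minus the radius times one
  direction, so the mean is the even part of \<phi> along a line, taken at sqrt (h(x) + \<delta>s).
  \<open>even_sqrt_taylor\<close> expands it in \<delta>s with base point h(x).\<close>

lemma polar_expansion:
  assumes phi: "smooth \<phi>" and H: "0 \<le> H" and h: "\<And>x. \<bar>x\<bar> < \<rho> \<Longrightarrow> 0 \<le> h x \<and> h x \<le> H"
  shows "uniform_expansion n (polar_box \<rho>)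
    (\<lambda>\<delta> \<omega>. (\<phi> (polar h 1 \<delta> \<omega>) + \<phi> (polar h (- 1) \<delta> \<omega>)) / 2)"
proof -
  define F where "F = (\<lambda>\<delta> \<omega>. (\<phi> (polar h 1 \<delta> \<omega>) + \<phi> (polar h (- 1) \<delta> \<omega>)) / 2)"
  define z where "z \<omega> = (vector [\<omega> $ 1, 0, 0] :: real ^ 3)" for \<omega> :: "real ^ 3"
  define v where "v \<omega> = (vector [0, cos (\<omega> $ 2), sin (\<omega> $ 2)] :: real ^ 3)" for \<omega> :: "real ^ 3"
  define L where "L \<omega> j r = directional_derivative j \<phi> (v \<omega>) (z \<omega> + r *\<^sub>R v \<omega>)" for \<omega> j r
  \<comment> \<open>The sign (-1)^j comes from the chain rule: \<open>N \<omega>\<close> is the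
    derivative sequence of the even part of \<open>L \<omega> 0\<close>.\<close>
  define N where "N \<omega> j r = (L \<omega> j r + (- 1) ^ j * L \<omega> j (- r)) / 2" for \<omega> j r
  \<comment> \<open>A radius beyond all those that occur, since (H + 2)^2 > H + 1.\<close>
  define R where "R = H + 2"
  have L: "(L \<omega> j has_real_derivative L \<omega> (Suc j) r) (at r)" for \<omega> j r
    unfolding L_def by (rule has_real_derivative_directional[OF phi])
  have N1: "(N \<omega> j has_real_derivative N \<omega> (Suc j) r) (at r)" for \<omega> j r
  proof -
    have "((\<lambda>r. L \<omega> j (- r)) has_real_derivative L \<omega> (Suc j) (- r) * - 1) (at r)"
      by (rule DERIV_chain2[OF L]) (auto intro!: derivative_eq_intros)
    from DERIV_cdivide[OF DERIV_add[OF L DERIV_cmult[OF this]]]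
    show ?thesis unfolding N_def[abs_def] by simp
  qed
  have N2: "N \<omega> 0 (- r) = N \<omega> 0 r" for \<omega> r by (simp add: N_def)
  have v: "norm (v \<omega>) \<le> 2" for \<omega>
  proof -
    have "norm (v \<omega>) \<le> \<bar>cos (\<omega> $ 2)\<bar> + \<bar>sin (\<omega> $ 2)\<bar>"
      using norm_le_l1_cart[of "v \<omega>"] by (simp add: v_def sum_3)
    with abs_cos_le_one[of "\<omega> $ 2"] abs_sin_le_one[of "\<omega> $ 2"] show ?thesis by linarith
  qed
  have z: "norm (z \<omega>) \<le> \<rho>" if "\<omega> \<in> polar_box \<rho>" for \<omega>
    using norm_le_l1_cart[of "z \<omega>"] that by (simp add: z_def sum_3 polar_box_def)
  \<comment> \<open>One constant per order for all directions and base points; it gives the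
    uniformity on the box.\<close>
  have "\<forall>j. \<exists>C. \<forall>p y. norm p \<le> 2 \<longrightarrow> norm y \<le> \<rho> + R * 2 \<longrightarrow> \<bar>directional_derivative j \<phi> p y\<bar> \<le> C"
    using directional_derivative_bounded[OF phi] by metis
  from choice[OF this] obtain C where C:
    "\<And>j p y. norm p \<le> 2 \<Longrightarrow> norm y \<le> \<rho> + R * 2 \<Longrightarrow> \<bar>directional_derivative j \<phi> p y\<bar> \<le> C j" by blast
  have LC: "\<bar>L \<omega> j r\<bar> \<le> C j" if "\<omega> \<in> polar_box \<rho>" "\<bar>r\<bar> \<le> R" for \<omega> j r
    unfolding L_def
  proof (rule C[OF v])
    have "norm (r *\<^sub>R v \<omega>) \<le> R * 2" unfolding norm_scaleR using that v H by (intro mult_mono) (auto simp: R_def)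
    then show "norm (z \<omega> + r *\<^sub>R v \<omega>) \<le> \<rho> + R * 2"
      using z[OF that(1)] norm_triangle_ineq[of "z \<omega>" "r *\<^sub>R v \<omega>"] by linarith
  qed
  have N3: "\<bar>N \<omega> j r\<bar> \<le> C j" if "\<omega> \<in> polar_box \<rho>" "\<bar>r\<bar> \<le> R" for \<omega> j r
  proof -
    have "\<bar>(- 1) ^ j * L \<omega> j (- r)\<bar> \<le> C j" using LC[OF that(1), of "- r" j] that by (simp add: abs_mult)
    moreover have "\<bar>(a + b) / 2\<bar> \<le> c" if "\<bar>a\<bar> \<le> c" "\<bar>b\<bar> \<le> c" for a b c :: real
      using that by (auto simp: abs_le_iff)
    ultimately show ?thesis using LC[OF that, of j] unfolding N_def by blast
  qed
  have hR: "0 \<le> h (\<omega> $ 1)" "h (\<omega> $ 1) \<le> H" if "\<omega> \<in> polar_box \<rho>" for \<omega>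
    using h[of "\<omega> $ 1"] that by (auto simp: polar_box_def)
  have sqrtR: "sqrt (h (\<omega> $ 1) + \<eta>) < R" if "\<omega> \<in> polar_box \<rho>" "\<eta> \<le> 1" for \<omega> \<eta>
  proof (rule real_less_lsqrt)
    have "H + 1 < R\<^sup>2" using H by (simp add: R_def power2_eq_square algebra_simps)
      (smt (verit) mult_nonneg_nonneg)
    then show "h (\<omega> $ 1) + \<eta> < R\<^sup>2" using hR[OF that(1)] that(2) by linarith
  qed (use H in \<open>simp add: R_def\<close>)
  define c where "c k \<omega> = (even_quotient ^^ k) (N \<omega>) 0 (sqrt (h (\<omega> $ 1))) / fact k" for k \<omega>
  have c: "bounded (c k ` polar_box \<rho>)" for k
  proof -
    have "\<bar>c k \<omega>\<bar> \<le> C (0 + 2 * k) / fact k" if w: "\<omega> \<in> polar_box \<rho>" for \<omega>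
    proof -
      have "\<bar>sqrt (h (\<omega> $ 1))\<bar> \<le> R" using sqrtR[OF w, of 0] hR[OF w] by simp
      then have "\<bar>(even_quotient ^^ k) (N \<omega>) 0 (sqrt (h (\<omega> $ 1)))\<bar> \<le> C (0 + 2 * k)"
        using even_quotient_iterate[where N = "N \<omega>" and m = C and R = R and k = k and j = 0
              and r = "sqrt (h (\<omega> $ 1))", OF N1 N2 N3[OF w]] by simp
      then show ?thesis unfolding c_def abs_divide by (simp add: divide_right_mono)
    qed
    then show ?thesis unfolding bounded_iff by auto
  qed
  define S where "S = (\<lambda>\<delta> \<omega>. \<Sum>k<n. c k \<omega> * (\<delta> * \<omega> $ 3) ^ k)"
  have SE: "uniform_expansion n (polar_box \<rho>) S"
    unfolding S_def
    by (intro uniform_expansion_sum uniform_expansion_mult uniform_expansion_power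
         uniform_expansion_const[OF c] uniform_expansion_delta uniform_expansion_component bounded_polar_box)
  have FN: "F \<delta> \<omega> = N \<omega> 0 (sqrt (h (\<omega> $ 1) + \<delta> * \<omega> $ 3))" for \<delta> \<omega>
  proof -
    have "polar h \<sigma> \<delta> \<omega> = z \<omega> + (\<sigma> * sqrt (h (\<omega> $ 1) + \<delta> * \<omega> $ 3)) *\<^sub>R v \<omega>" for \<sigma>
      by (simp add: vec_eq_iff forall_3 z_def v_def mult.assoc)
    then show ?thesis by (simp add: F_def N_def L_def)
  qed
  have "\<forall>\<^sub>F \<delta> in at_right 0. \<forall>\<omega>\<in>polar_box \<rho>. \<bar>(F \<delta> \<omega> - S \<delta> \<omega>) / \<delta> ^ n\<bar> \<le> C (2 * n)"
    using eventually_at_right_0_bounds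
  proof eventually_elim
    case (elim \<delta>)
    show ?case
    proof
      fix \<omega> assume w: "\<omega> \<in> polar_box \<rho>"
      then have w3: "0 < \<omega> $ 3" "\<omega> $ 3 < 1" by (auto simp: polar_box_def)
      have \<eta>: "0 < \<delta> * \<omega> $ 3" "\<delta> * \<omega> $ 3 \<le> 1" using elim w3 by (auto intro: mult_le_one)
      have "\<bar>F \<delta> \<omega> - S \<delta> \<omega>\<bar> \<le> C (2 * n) * (\<delta> * \<omega> $ 3) ^ n"
        unfolding FN S_def c_def
        by (rule even_sqrt_taylor[OF N1 N2 N3[OF w] hR(1)[OF w] \<eta>(1) sqrtR[OF w \<eta>(2)]])
      also have "\<dots> \<le> C (2 * n) * \<delta> ^ n"
      proof (rule mult_left_mono)
        show "(\<delta> * \<omega> $ 3) ^ n \<le> \<delta> ^ n"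
          using elim w3 by (intro power_mono) (auto simp: mult_le_cancel_left2)
        show "0 \<le> C (2 * n)"
          using H by (intro order_trans[OF abs_ge_zero N3[OF w, of 0]]) (simp add: R_def)
      qed
      finally show "\<bar>(F \<delta> \<omega> - S \<delta> \<omega>) / \<delta> ^ n\<bar> \<le> C (2 * n)"
        using elim by (simp add: abs_divide pos_divide_le_eq)
    qed
  qed
  then have "uniform_expansion n (polar_box \<rho>) (\<lambda>\<delta> \<omega>. S \<delta> \<omega> + \<delta> ^ n * ((F \<delta> \<omega> - S \<delta> \<omega>) / \<delta> ^ n))"
    by (intro uniform_expansion_add SE uniform_expansion_delta_power_mult) auto
  then show ?thesis
    unfolding F_def[symmetric]
    by (rule uniform_expansion_cong) (rule eventually_mono[OF eventually_at_right_0_bounds], simp)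
qed

text \<open>The support of \<phi> excludes points with |x| at least \<rho>, and the plane z = 0 is a
  null set. What remains of the sublevel set is the disjoint union of two half shells, the images
  for \<sigma> = 1 and \<sigma> = -1. Adding them over their common box is what symmetrizes
  \<phi>.\<close>

lemma sublevel_integral_polar:
  fixes f :: "real ^ 3 \<Rightarrow> real"
  assumes phi: "test_function \<rho> \<phi>" and f: "\<And>x. f x = (x $ 2)\<^sup>2 + (x $ 3)\<^sup>2 - h (x $ 1)"
    and h: "\<And>x. \<bar>x\<bar> < \<rho> \<Longrightarrow> 0 \<le> h x" and dh: "\<And>x. (h has_real_derivative h' x) (at x)"
    and \<delta>: "0 < \<delta>"
  shows "sublevel_integral f \<phi> \<delta> =
    \<delta> * (LINT \<omega>:polar_box \<rho>|lborel. (\<phi> (polar h 1 \<delta> \<omega>) + \<phi> (polar h (- 1) \<delta> \<omega>)) / 2)"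
proof -
  have smooth: "smooth \<phi>" and supp: "closure {x. \<phi> x \<noteq> 0} \<subseteq> ball 0 \<rho>"
    using phi by (auto simp: test_function_def)
  have hc: "continuous_on S h" for S
    using dh by (intro continuous_at_imp_continuous_on ballI DERIV_isCont) blast
  have hc': "continuous_on UNIV (\<lambda>x :: real ^ 3. h (x $ 1))"
    by (rule continuous_on_compose2[OF hc[of UNIV]]) (intro continuous_intros, simp)
  have fc: "continuous_on UNIV f" unfolding f by (intro continuous_intros hc')
  define A where "A \<sigma> = polar h \<sigma> \<delta> ` polar_box \<rho>" for \<sigma>
  define S where "S = {x. 0 < f x \<and> f x < \<delta>}"
  have A_eq: "A \<sigma> = {x. \<bar>x $ 1\<bar> < \<rho> \<and> 0 < \<sigma> * x $ 3 \<and> 0 < f x \<and> f x < \<delta>}"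
    if "\<sigma> = 1 \<or> \<sigma> = - 1" for \<sigma>
    unfolding A_def f by (rule polar_image(1)[OF that \<delta> h])
  have A_borel: "A \<sigma> \<in> sets borel" if "\<sigma> = 1 \<or> \<sigma> = - 1" for \<sigma>
    unfolding A_eq[OF that] Collect_conj_eq
    by (intro borel_open open_Int open_Collect_less continuous_intros fc)
  have S_borel: "S \<in> sets borel"
    unfolding S_def Collect_conj_eq by (intro borel_open open_Int open_Collect_less continuous_intros fc)
  note int = test_function_integrable[OF phi]
  have null: "{x :: real ^ 3. x $ 3 = 0} \<in> null_sets lborel"
  proof -
    have "closed {x :: real ^ 3. x $ 3 = 0}" by (intro closed_Collect_eq continuous_intros)
    then have "{x :: real ^ 3. x $ 3 = 0} \<in> sets lborel" by (simp add: borel_closed)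
    then show ?thesis
      using negligible_standard_hyperplane_cart[of "3 :: 3"]
      by (simp add: negligible_iff_null_sets null_sets_completion_iff)
  qed
  have "sublevel_integral f \<phi> \<delta> = (LINT x:S|lborel. \<phi> x)"
    by (simp add: sublevel_integral_def S_def)
  also have "\<dots> = (LINT x:A 1 \<union> A (- 1)|lborel. \<phi> x)"
    unfolding set_lebesgue_integral_def
  proof (rule integral_cong_AE)
    show "(\<lambda>x. indicator S x *\<^sub>R \<phi> x) \<in> borel_measurable lborel"
      using int[OF S_borel] unfolding set_integrable_def by (rule borel_measurable_integrable)
    show "(\<lambda>x. indicator (A 1 \<union> A (- 1)) x *\<^sub>R \<phi> x) \<in> borel_measurable lborel"
      using int[OF sets.Un[OF A_borel[of 1] A_borel[of "- 1"]]]
      unfolding set_integrable_def by (intro borel_measurable_integrable) simp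
    show "AE x in lborel. indicator S x *\<^sub>R \<phi> x = indicator (A 1 \<union> A (- 1)) x *\<^sub>R \<phi> x"
      using AE_not_in[OF null]
    proof eventually_elim
      case (elim x)
      show ?case
      proof (cases "\<phi> x = 0")
        case False
        then have "norm x < \<rho>" using supp closure_subset[of "{x. \<phi> x \<noteq> 0}"] by auto
        then have "\<bar>x $ 1\<bar> < \<rho>" using component_le_norm_cart[of x 1] by linarith
        then have "x \<in> S \<longleftrightarrow> x \<in> A 1 \<union> A (- 1)"
          using elim by (auto simp: A_eq S_def)
        then show ?thesis by (simp add: indicator_def)
      qed simp
    qed
  qed
  also have "\<dots> = (LINT x:A 1|lborel. \<phi> x) + (LINT x:A (- 1)|lborel. \<phi> x)"
  proof -
    have "A 1 \<inter> A (- 1) = {}" by (auto simp: A_eq)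
    from set_integral_Un[OF this int[OF A_borel] int[OF A_borel]] show ?thesis by simp
  qed
  also have "\<dots> = \<delta> / 2 * (LINT \<omega>:polar_box \<rho>|lborel. \<phi> (polar h 1 \<delta> \<omega>)) +
      \<delta> / 2 * (LINT \<omega>:polar_box \<rho>|lborel. \<phi> (polar h (- 1) \<delta> \<omega>))"
  proof -
    have "(LINT x:A \<sigma>|lborel. \<phi> x) = \<delta> / 2 * (LINT \<omega>:polar_box \<rho>|lborel. \<phi> (polar h \<sigma> \<delta> \<omega>))"
      if "\<sigma> = 1 \<or> \<sigma> = - 1" for \<sigma>
      unfolding A_def
      by (rule set_integral_polar[OF that \<delta> h dh smooth_continuous[OF smooth] int[OF A_borel[OF that], unfolded A_def]])
    from this[of 1] this[of "- 1"] show ?thesis by simp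
  qed
  also have "\<dots> = \<delta> * (LINT \<omega>:polar_box \<rho>|lborel. (\<phi> (polar h 1 \<delta> \<omega>) + \<phi> (polar h (- 1) \<delta> \<omega>)) / 2)"
  proof -
    have "set_integrable lborel (polar_box \<rho>) (\<lambda>\<omega>. \<phi> (polar h \<sigma> \<delta> \<omega>))" for \<sigma>
    proof -
      have "set_integrable lborel (closure (polar_box \<rho>)) (\<lambda>\<omega>. \<phi> (polar h \<sigma> \<delta> \<omega>))"
        unfolding set_integrable_def
        by (rule borel_integrable_compact)
          (simp add: compact_closure bounded_polar_box,
            rule continuous_on_compose2[OF smooth_continuous[OF smooth] continuous_on_polar[OF hc]], simp)
      then show ?thesis
        by (rule set_integrable_subset) (simp_all add: open_polar_box borel_open closure_subset)
    qed
    then show ?thesis by (simp add: set_integral_add(2) algebra_simps)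
  qed
  finally show ?thesis .
qed

section \<open>The case t < 0\<close>

lemma growth_index_U_neg:
  assumes t: "t < 0"
  shows "has_growth_index (U t) 1"
proof -
  \<comment> \<open>The function h(x) = x^2 (- t - x^2) is nonnegative exactly for |x| at most sqrt
    (- t), which dictates the size of the supports.\<close>
  define \<rho> where "\<rho> = sqrt (- t)"
  define h where "h x = - t * x\<^sup>2 - x ^ 4" for x :: real
  have \<rho>: "0 < \<rho>" "\<rho>\<^sup>2 = - t" using t by (simp_all add: \<rho>_def)
  have h: "0 \<le> h x \<and> h x \<le> - t * x\<^sup>2" if "\<bar>x\<bar> < \<rho>" for x
  proof -
    have "x\<^sup>2 \<le> - t" using that \<rho> power_mono[of "\<bar>x\<bar>" \<rho> 2] by simp
    then have "0 \<le> x\<^sup>2 * (- t - x\<^sup>2)" by (intro mult_nonneg_nonneg) auto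
    moreover have "x\<^sup>2 * (- t - x\<^sup>2) = h x"
      by (simp add: h_def algebra_simps power2_eq_square power4_eq_xxxx)
    ultimately show ?thesis by (simp add: h_def)
  qed
  have h2: "0 \<le> h x \<and> h x \<le> t\<^sup>2" if "\<bar>x\<bar> < \<rho>" for x
  proof -
    have "x\<^sup>2 \<le> - t" using that \<rho> power_mono[of "\<bar>x\<bar>" \<rho> 2] by simp
    then have "- t * x\<^sup>2 \<le> - t * - t" using t by (intro mult_left_mono) auto
    then show ?thesis using h[OF that] by (simp add: power2_eq_square)
  qed
  have dh: "(h has_real_derivative - t * (2 * x) - 4 * x ^ 3) (at x)" for x
    unfolding h_def by (auto intro!: derivative_eq_intros)
  have Uh: "U t x = (x $ 2)\<^sup>2 + (x $ 3)\<^sup>2 - h (x $ 1)" for x by (simp add: U_def h_def)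
  have "has_growth_index (U t) (real 1 / real 1)"
  proof (rule has_growth_indexI[OF admissible_phase_U \<rho>(1)])
    fix \<phi> :: "real ^ 3 \<Rightarrow> real" assume phi: "test_function \<rho> \<phi>"
    then have smooth: "smooth \<phi>" and nonneg: "\<And>x. 0 \<le> \<phi> x" and phi0: "0 < \<phi> 0"
      by (auto simp: test_function_def)
    define F where "F = (\<lambda>\<delta> \<omega>. (\<phi> (polar h 1 \<delta> \<omega>) + \<phi> (polar h (- 1) \<delta> \<omega>)) / 2)"
    have "isCont \<phi> 0"
      using smooth_continuous[OF smooth] by (simp add: continuous_on_eq_continuous_at)
    then have "\<forall>\<^sub>F x in nhds 0. \<phi> 0 / 2 < \<phi> x"
      unfolding isCont_def continuous_within tendsto_at_iff_tendsto_nhds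
      by (rule order_tendstoD) (use phi0 in simp)
    then obtain e where e: "0 < e" "\<And>x. norm x < e \<Longrightarrow> \<phi> 0 / 2 < \<phi> x"
      by (auto simp: eventually_nhds_metric)
    \<comment> \<open>For |x| < \<eta> this yields x^2 + h(x) at most (1 - t) x^2, hence at most e^2
      / 2. With \<delta>s < e^2 / 2 the image has norm below e, where \<phi> exceeds
      \<open>\<phi> 0 / 2\<close>. The other two bounds keep the ball inside the box.\<close>
    define \<eta> where "\<eta> = min (min \<rho> (1 / 2)) (e / sqrt (2 * (1 - t)))"
    have \<eta>: "0 < \<eta>" "\<eta> \<le> \<rho>" "\<eta> \<le> 1 / 2" "\<eta> \<le> e / sqrt (2 * (1 - t))"
      using e \<rho> t unfolding \<eta>_def by (simp, linarith, linarith, linarith)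
    have "\<eta>\<^sup>2 \<le> (e / sqrt (2 * (1 - t)))\<^sup>2" using \<eta> by (intro power_mono) auto
    also have "\<dots> = e\<^sup>2 / (2 * (1 - t))" using t by (simp add: power_divide)
    finally have \<eta>e: "(1 - t) * \<eta>\<^sup>2 \<le> e\<^sup>2 / 2" using t by (simp add: field_simps)
    \<comment> \<open>The centre of the box. Much of the shell stays away from 0, where \<phi> may
      vanish; the part over small x lies close to 0 and provides the lower bound.\<close>
    define \<omega>0 where "\<omega>0 = (vector [0, pi / 2, 1 / 2] :: real ^ 3)"
    have V: "\<bar>\<omega> $ 1\<bar> < \<eta> \<and> \<bar>\<omega> $ 2 - pi / 2\<bar> < \<eta> \<and> \<bar>\<omega> $ 3 - 1 / 2\<bar> < \<eta>" if "\<omega> \<in> ball \<omega>0 \<eta>" for \<omega>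
    proof -
      have "\<bar>(\<omega> - \<omega>0) $ i\<bar> < \<eta>" for i
        using that component_le_norm_cart[of "\<omega> - \<omega>0" i] by (simp add: dist_norm norm_minus_commute)
      from this[of 1] this[of 2] this[of 3] show ?thesis by (simp add: \<omega>0_def)
    qed
    have VW: "ball \<omega>0 \<eta> \<subseteq> polar_box \<rho>"
    proof
      fix \<omega> assume "\<omega> \<in> ball \<omega>0 \<eta>"
      from V[OF this] \<eta> pi_gt3 show "\<omega> \<in> polar_box \<rho>"
        unfolding polar_box_def mem_Collect_eq abs_less_iff by linarith
    qed
    have "((\<lambda>\<delta>. \<delta>) \<longlongrightarrow> 0) (at_right (0::real))" by (rule tendsto_ident_at)
    then have small: "\<forall>\<^sub>F \<delta> in at_right 0. \<delta> < e\<^sup>2 / 2"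
      by (rule order_tendstoD) (use e in simp)
    have pos: "\<forall>\<^sub>F \<delta> in at_right 0. \<forall>\<omega>\<in>ball \<omega>0 \<eta>. \<phi> 0 / 2 \<le> F \<delta> \<omega>"
      using small eventually_at_right_0_bounds
    proof eventually_elim
      case (elim \<delta>)
      show ?case
      proof
        fix \<omega> assume w: "\<omega> \<in> ball \<omega>0 \<eta>"
        then have wb: "\<omega> \<in> polar_box \<rho>" using VW by blast
        have w1: "\<bar>\<omega> $ 1\<bar> < \<rho>" and w3: "0 < \<omega> $ 3" "\<omega> $ 3 < 1" using wb by (auto simp: polar_box_def)
        have "(\<omega> $ 1)\<^sup>2 \<le> \<eta>\<^sup>2" using V[OF w] power_mono[of "\<bar>\<omega> $ 1\<bar>" \<eta> 2] by simp
        then have "(1 - t) * (\<omega> $ 1)\<^sup>2 \<le> (1 - t) * \<eta>\<^sup>2" using t by (intro mult_left_mono) auto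
        then have le: "(\<omega> $ 1)\<^sup>2 + - t * (\<omega> $ 1)\<^sup>2 \<le> e\<^sup>2 / 2"
          using \<eta>e by (simp add: algebra_simps)
        have d3: "\<delta> * \<omega> $ 3 < \<delta>" using elim w3 by (simp add: mult_less_cancel_left2)
        have h0: "0 \<le> h (\<omega> $ 1) + \<delta> * \<omega> $ 3" using h[OF w1] elim w3 by simp
        have small': "norm (polar h \<sigma> \<delta> \<omega>) < e" if "\<sigma>\<^sup>2 = 1" for \<sigma>
        proof -
          have "(norm (polar h \<sigma> \<delta> \<omega>))\<^sup>2 = (\<omega> $ 1)\<^sup>2 + ((polar h \<sigma> \<delta> \<omega> $ 2)\<^sup>2 + (polar h \<sigma> \<delta> \<omega> $ 3)\<^sup>2)"
            unfolding power2_norm_eq_inner inner_vec_def sum_3 by (simp add: power2_eq_square)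
          also have "\<dots> = (\<omega> $ 1)\<^sup>2 + (h (\<omega> $ 1) + \<delta> * \<omega> $ 3)"
            unfolding polar_radius[where h = h and \<delta> = \<delta> and \<omega> = \<omega> and \<sigma> = \<sigma>, OF that h0] ..
          also have "\<dots> < e\<^sup>2" using h[OF w1] le d3 elim by linarith
          finally show ?thesis using e(1) by (simp add: power2_less_imp_less)
        qed
        have "\<phi> 0 / 2 < \<phi> (polar h 1 \<delta> \<omega>)" "\<phi> 0 / 2 < \<phi> (polar h (- 1) \<delta> \<omega>)"
          by (intro e(2) small'; simp)+
        then show "\<phi> 0 / 2 \<le> F \<delta> \<omega>" by (simp add: F_def)
      qed
    qed
    have hc: "continuous_on UNIV h"
      using dh by (intro continuous_at_imp_continuous_on ballI DERIV_isCont) blast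
    have cont: "continuous_on (polar_box \<rho>) (F \<delta>)" for \<delta>
    proof -
      have "continuous_on (polar_box \<rho>) (\<lambda>\<omega>. \<phi> (polar h \<sigma> \<delta> \<omega>))" for \<sigma>
        by (rule continuous_on_compose2[OF smooth_continuous[OF smooth] continuous_on_polar[OF hc]]) simp
      then show ?thesis unfolding F_def by (intro continuous_intros) auto
    qed
    have "(\<forall>n. uniform_expansion n (UNIV :: unit set) (\<lambda>\<delta> _. LINT \<omega>:polar_box \<rho>|lborel. F \<delta> \<omega>)) \<and>
       0 < \<phi> 0 / 2 * measure lborel (ball \<omega>0 \<eta>) \<and>
       (\<forall>\<^sub>F \<delta> in at_right 0. \<phi> 0 / 2 * measure lborel (ball \<omega>0 \<eta>) \<le> (LINT \<omega>:polar_box \<rho>|lborel. F \<delta> \<omega>))"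
    proof (rule set_integral_expansion[OF _ bounded_polar_box _ cont _ VW \<eta>(1) _ pos])
      show "uniform_expansion n (polar_box \<rho>) F" for n
        unfolding F_def by (rule polar_expansion[OF smooth _ h2]) simp
      show "\<forall>\<^sub>F \<delta> in at_right 0. \<forall>\<omega>\<in>polar_box \<rho>. 0 \<le> F \<delta> \<omega>"
        using nonneg by (simp add: F_def)
    qed (use phi0 in \<open>simp_all add: open_polar_box borel_open\<close>)
    moreover have "\<forall>\<^sub>F \<delta> in at_right 0. sublevel_integral (U t) \<phi> (\<delta> ^ 1) =
        \<delta> ^ 1 * (LINT \<omega>:polar_box \<rho>|lborel. F \<delta> \<omega>)"
      using eventually_at_right_0_bounds
    proof eventually_elim
      case (elim \<delta>)
      have "sublevel_integral (U t) \<phi> \<delta> = \<delta> * (LINT \<omega>:polar_box \<rho>|lborel. F \<delta> \<omega>)"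
        unfolding F_def
        by (rule sublevel_integral_polar[OF phi Uh _ dh]) (use elim h in auto)
      then show ?case by simp
    qed
    ultimately show "\<exists>J \<kappa>. (\<forall>n. uniform_expansion n (UNIV :: unit set) (\<lambda>\<delta> _. J \<delta>)) \<and>
        0 < \<kappa> \<and> (\<forall>\<^sub>F \<delta> in at_right 0. \<kappa> \<le> J \<delta>) \<and>
        (\<forall>\<^sub>F \<delta> in at_right 0. sublevel_integral (U t) \<phi> (\<delta> ^ 1) = \<delta> ^ 1 * J \<delta>)"
      by (intro exI[of _ "\<lambda>\<delta>. LINT \<omega>:polar_box \<rho>|lborel. F \<delta> \<omega>"]
            exI[of _ "\<phi> 0 / 2 * measure lborel (ball \<omega>0 \<eta>)"]) (elim conjE, intro conjI)
  qed simp_all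
  then show ?thesis by simp
qed

theorem theorem1p7:
  fixes t :: real
  shows "(t > 0 \<longrightarrow> has_growth_index (U t) (3 / 2)) \<and>
         has_growth_index (U 0) (5 / 4) \<and>
         (t < 0 \<longrightarrow> has_growth_index (U t) 1)"
  using growth_index_U_pos growth_index_U_0 growth_index_U_neg by blast

end
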